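(* Let $\mathcal V$ be a variety with a difference term and $Q\in\mathcal V$. The Schur multiplier of $Q$ in $\mathcal V$ is invariant under presentations; that is, if $F/\alpha\cong Q\cong G/\beta$ are two free presentations of $Q$ in $\mathcal V$, then the associated Schur multipliers are isomorphic algebras: $$\kappa_{\alpha/[\alpha,1]\,1}\big(F/[\alpha,1]\,((\alpha\wedge[1,1])/[\alpha,1])\big)\cong\kappa_{\beta/[\beta,1]\,1}\big(G/[\beta,1]\,((\beta\wedge[1,1])/[\beta,1])\big).$$
   Context: Algebras are universal algebras in a signature $\tau$; $[\alpha,\beta]$ is the term-condition commutator of congruences; $1$ is the greatest congruence. A variety $\mathcal V$ has a difference term if there is a ternary term $m$ with $m(x,x,y)=y$ in $\mathcal V$ and $(x,m(x,y,y))\in[\alpha,\alpha]$ whenever $A\in\mathcal V$ and $(x,y)\in\alpha\in\mathrm{Con}\,A$; it is assumed that $m$ is a fundamental operation symbol of $\tau$. A free presentation of $Q$ in $\mathcal V$ is $F/\theta\cong Q$ with $F$ a free algebra in $\mathcal V$ and $\theta\in\mathrm{Con}\,F$. For an algebra $A$ and $\alpha\in\mathrm{Con}\,A$, $A(\alpha)$ is $\alpha$ viewed as a subalgebra of $A\times A$; $\Delta_{\alpha 1}$ is the congruence of $A(\alpha)$ generated by all pairs $\langle(u,u),(v,v)\rangle$ with $u,v\in A$; and $\kappa_{\alpha1}:A(\alpha)\to A(\alpha)/\Delta_{\alpha1}$ is the quotient map. For $\gamma\le\alpha$, $A(\gamma)$ is a subalgebra of $A(\alpha)$ and $\kappa_{\alpha1}(A(\gamma))$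 is its image. The Schur multiplier of $Q$ associated with a free presentation $F/\theta\cong Q$ in $\mathcal V$ is the abelian algebra $\kappa_{\theta/[\theta,1]\,1}\big(F/[\theta,1]\,((\theta\wedge[1,1])/[\theta,1])\big)$, i.e. the image under $\kappa_{\alpha1}$, for $A=F/[\theta,1]$ and $\alpha=\theta/[\theta,1]$, of the subalgebra $A(\gamma)\le A(\alpha)$ with $\gamma=(\theta\wedge[1,1])/[\theta,1]$. *)

theory Defs
  imports Main
begin

text \<open>
  A signature is given by a type of operation symbols \<open>'f\<close> together with an arity function
  \<open>ar :: 'f \<Rightarrow> nat\<close>. Operations are only meaningful on argument lists of the right length over
  the carrier. As usual in universal algebra, carriers are nonempty.
\<close>

record ('f, 'a) algebra =
  carrier :: "'a set"
  oper :: "'f \<Rightarrow> 'a list \<Rightarrow> 'a"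

definition is_algebra :: "('f \<Rightarrow> nat) \<Rightarrow> ('f, 'a) algebra \<Rightarrow> bool" where
  "is_algebra ar A \<longleftrightarrow> carrier A \<noteq> {} \<and>
     (\<forall>f xs. length xs = ar f \<and> set xs \<subseteq> carrier A \<longrightarrow> oper A f xs \<in> carrier A)"

definition is_hom ::
  "('f \<Rightarrow> nat) \<Rightarrow> ('f, 'a) algebra \<Rightarrow> ('f, 'b) algebra \<Rightarrow> ('a \<Rightarrow> 'b) \<Rightarrow> bool" where
  "is_hom ar A B h \<longleftrightarrow> (\<forall>x\<in>carrier A. h x \<in> carrier B) \<and>
     (\<forall>f xs. length xs = ar f \<and> set xs \<subseteq> carrier A \<longrightarrow>
        h (oper A f xs) = oper B f (map h xs))"

definition isomorphic ::
  "('f \<Rightarrow> nat) \<Rightarrow> ('f, 'a) algebra \<Rightarrow> ('f, 'b) algebra \<Rightarrow> bool" where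
  "isomorphic ar A B \<longleftrightarrow> (\<exists>h. is_hom ar A B h \<and> bij_betw h (carrier A) (carrier B))"


section \<open>Terms and varieties\<close>

datatype ('f, 'v) tm = Var 'v | App 'f "('f, 'v) tm list"

inductive wf_tm :: "('f \<Rightarrow> nat) \<Rightarrow> ('f, 'v) tm \<Rightarrow> bool" for ar :: "'f \<Rightarrow> nat" where
  "wf_tm ar (Var x)"
| "length ts = ar f \<Longrightarrow> (\<And>t. t \<in> set ts \<Longrightarrow> wf_tm ar t) \<Longrightarrow> wf_tm ar (App f ts)"

primrec eval_tm :: "('f, 'a) algebra \<Rightarrow> ('v \<Rightarrow> 'a) \<Rightarrow> ('f, 'v) tm \<Rightarrow> 'a" where
  "eval_tm A \<rho> (Var x) = \<rho> x"
| "eval_tm A \<rho> (App f ts) = oper A f (map (eval_tm A \<rho>) ts)"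

type_synonym 'f identities = "(('f, nat) tm \<times> ('f, nat) tm) set"

definition wf_identities :: "('f \<Rightarrow> nat) \<Rightarrow> 'f identities \<Rightarrow> bool" where
  "wf_identities ar E \<longleftrightarrow> (\<forall>(s, t)\<in>E. wf_tm ar s \<and> wf_tm ar t)"

text \<open>A variety is an equational class; it is represented by a set \<open>E\<close> of defining identities, so
  that membership makes sense for algebras over every carrier type.\<close>

definition in_variety :: "('f \<Rightarrow> nat) \<Rightarrow> 'f identities \<Rightarrow> ('f, 'a) algebra \<Rightarrow> bool" where
  "in_variety ar E A \<longleftrightarrow> is_algebra ar A \<and>
     (\<forall>(s, t)\<in>E. \<forall>\<rho>. range \<rho> \<subseteq> carrier A \<longrightarrow> eval_tm A \<rho> s = eval_tm A \<rho> t)"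

definition subuniverse :: "('f \<Rightarrow> nat) \<Rightarrow> ('f, 'a) algebra \<Rightarrow> 'a set \<Rightarrow> bool" where
  "subuniverse ar A S \<longleftrightarrow> S \<subseteq> carrier A \<and>
     (\<forall>f xs. length xs = ar f \<and> set xs \<subseteq> S \<longrightarrow> oper A f xs \<in> S)"

definition generated :: "('f \<Rightarrow> nat) \<Rightarrow> ('f, 'a) algebra \<Rightarrow> 'a set \<Rightarrow> 'a set" where
  "generated ar A X = \<Inter>{S. subuniverse ar A S \<and> X \<subseteq> S}"

text \<open>
  Universal mapping property over a generating set \<open>X\<close>. HOL cannot quantify over all carrier types
  inside a formula. The test algebras \<open>B\<close> therefore range over the type \<open>('f, 'a) tm set\<close>, which
  contains a copy of the free algebra of the variety over \<open>X\<close> (classes of terms with variables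
  in \<open>X\<close>). Testing against that copy already makes \<open>F\<close> isomorphic to it, so nothing is lost by
  this restriction.
\<close>

definition freely_generated ::
  "('f \<Rightarrow> nat) \<Rightarrow> 'f identities \<Rightarrow> ('f, 'a) algebra \<Rightarrow> 'a set \<Rightarrow> bool" where
  "freely_generated ar E F X \<longleftrightarrow> in_variety ar E F \<and> X \<subseteq> carrier F \<and>
     generated ar F X = carrier F \<and>
     (\<forall>B :: ('f, ('f, 'a) tm set) algebra. in_variety ar E B \<longrightarrow>
        (\<forall>g. (\<forall>x\<in>X. g x \<in> carrier B) \<longrightarrow>
           (\<exists>h. is_hom ar F B h \<and> (\<forall>x\<in>X. h x = g x))))"

definition free_algebra :: "('f \<Rightarrow> nat) \<Rightarrow> 'f identities \<Rightarrow> ('f, 'a) algebra \<Rightarrow> bool" where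
  "free_algebra ar E F \<longleftrightarrow> (\<exists>X. freely_generated ar E F X)"


section \<open>Congruences, quotients and the term-condition commutator\<close>

definition congruence :: "('f \<Rightarrow> nat) \<Rightarrow> ('f, 'a) algebra \<Rightarrow> ('a \<times> 'a) set \<Rightarrow> bool" where
  "congruence ar A \<theta> \<longleftrightarrow> equiv (carrier A) \<theta> \<and>
     (\<forall>f xs ys. length xs = ar f \<and> list_all2 (\<lambda>x y. (x, y) \<in> \<theta>) xs ys \<longrightarrow>
        (oper A f xs, oper A f ys) \<in> \<theta>)"

definition top_con :: "('f, 'a) algebra \<Rightarrow> ('a \<times> 'a) set" where
  "top_con A = carrier A \<times> carrier A"

definition Cg :: "('f \<Rightarrow> nat) \<Rightarrow> ('f, 'a) algebra \<Rightarrow> ('a \<times> 'a) set \<Rightarrow> ('a \<times> 'a) set" where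
  "Cg ar A R = \<Inter>{\<theta>. congruence ar A \<theta> \<and> R \<subseteq> \<theta>}"

text \<open>On classes of a congruence, the set under \<open>\<theta> ``\<close> lies in a single class.\<close>

definition quot_alg :: "('f, 'a) algebra \<Rightarrow> ('a \<times> 'a) set \<Rightarrow> ('f, 'a set) algebra" where
  "quot_alg A \<theta> =
     \<lparr>carrier = carrier A // \<theta>,
      oper = (\<lambda>f Xs. \<theta> `` {oper A f xs | xs. list_all2 (\<in>) xs Xs})\<rparr>"

text \<open>The congruence \<open>\<alpha>/\<delta>\<close> of \<open>A/\<delta>\<close>, for \<open>\<delta> \<le> \<alpha>\<close>.\<close>

definition quot_con :: "('a \<times> 'a) set \<Rightarrow> ('a \<times> 'a) set \<Rightarrow> ('a set \<times> 'a set) set" where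
  "quot_con \<alpha> \<delta> = {(\<delta> `` {x}, \<delta> `` {y}) | x y. (x, y) \<in> \<alpha>}"

text \<open>The term condition \<open>C(\<alpha>,\<beta>;\<delta>)\<close>. The variables \<open>Inl i\<close> and \<open>Inr j\<close> form the two blocks of
  arguments of the term operation.\<close>

definition centralizes :: "('f \<Rightarrow> nat) \<Rightarrow> ('f, 'a) algebra \<Rightarrow>
    ('a \<times> 'a) set \<Rightarrow> ('a \<times> 'a) set \<Rightarrow> ('a \<times> 'a) set \<Rightarrow> bool" where
  "centralizes ar A \<alpha> \<beta> \<delta> \<longleftrightarrow>
     (\<forall>(t :: ('f, nat + nat) tm) a b c d.
        wf_tm ar t \<and> (\<forall>i. (a i, b i) \<in> \<alpha>) \<and> (\<forall>j. (c j, d j) \<in> \<beta>) \<and>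
        (eval_tm A (case_sum a c) t, eval_tm A (case_sum a d) t) \<in> \<delta> \<longrightarrow>
        (eval_tm A (case_sum b c) t, eval_tm A (case_sum b d) t) \<in> \<delta>)"

definition commutator :: "('f \<Rightarrow> nat) \<Rightarrow> ('f, 'a) algebra \<Rightarrow>
    ('a \<times> 'a) set \<Rightarrow> ('a \<times> 'a) set \<Rightarrow> ('a \<times> 'a) set" where
  "commutator ar A \<alpha> \<beta> = \<Inter>{\<delta>. congruence ar A \<delta> \<and> centralizes ar A \<alpha> \<beta> \<delta>}"

text \<open>
  The fundamental operation \<open>m\<close> is a difference term. Again the algebras must range over a fixed
  type. A failure of either condition in an algebra of the variety, at elements \<open>x\<close>, \<open>y\<close>, is a
  failure in the subalgebra generated by \<open>x\<close> and \<open>y\<close> (with \<open>\<alpha>\<close> restricted to it), because the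
  commutator of the restrictions is contained in the commutator. Every 2-generated
  algebra of the variety is isomorphic to a quotient of the algebra of terms over \<open>nat\<close>, hence
  to one with carrier in \<open>('f, nat) tm set\<close>, so that this type suffices.
\<close>

definition difference_term :: "('f \<Rightarrow> nat) \<Rightarrow> 'f identities \<Rightarrow> 'f \<Rightarrow> bool" where
  "difference_term ar E m \<longleftrightarrow> ar m = 3 \<and>
     (\<forall>A :: ('f, ('f, nat) tm set) algebra. in_variety ar E A \<longrightarrow>
        (\<forall>x\<in>carrier A. \<forall>y\<in>carrier A. oper A m [x, x, y] = y) \<and>
        (\<forall>\<alpha> x y. congruence ar A \<alpha> \<and> (x, y) \<in> \<alpha> \<longrightarrow>
           (x, oper A m [x, y, y]) \<in> commutator ar A \<alpha> \<alpha>))"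


section \<open>The Schur multiplier\<close>

text \<open>\<open>A(\<alpha>)\<close>: the congruence \<open>\<alpha>\<close> as a subalgebra of \<open>A \<times> A\<close>.\<close>

definition con_alg :: "('f, 'a) algebra \<Rightarrow> ('a \<times> 'a) set \<Rightarrow> ('f, 'a \<times> 'a) algebra" where
  "con_alg A \<alpha> =
     \<lparr>carrier = \<alpha>,
      oper = (\<lambda>f ps. (oper A f (map fst ps), oper A f (map snd ps)))\<rparr>"

text \<open>\<open>\<Delta>\<^bsub>\<alpha>1\<^esub>\<close>\<close>

definition Delta :: "('f \<Rightarrow> nat) \<Rightarrow> ('f, 'a) algebra \<Rightarrow> ('a \<times> 'a) set \<Rightarrow>
    (('a \<times> 'a) \<times> ('a \<times> 'a)) set" where
  "Delta ar A \<alpha> = Cg ar (con_alg A \<alpha>)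
     {((u, u), (v, v)) | u v. u \<in> carrier A \<and> v \<in> carrier A}"

definition kappa :: "('f \<Rightarrow> nat) \<Rightarrow> ('f, 'a) algebra \<Rightarrow> ('a \<times> 'a) set \<Rightarrow>
    'a \<times> 'a \<Rightarrow> ('a \<times> 'a) set" where
  "kappa ar A \<alpha> p = Delta ar A \<alpha> `` {p}"

text \<open>\<open>\<kappa>\<^bsub>\<alpha>1\<^esub>(A(\<gamma>))\<close>, as a subalgebra of \<open>A(\<alpha>)/\<Delta>\<^bsub>\<alpha>1\<^esub>\<close>, for \<open>\<gamma> \<le> \<alpha>\<close>.\<close>

definition kappa_image :: "('f \<Rightarrow> nat) \<Rightarrow> ('f, 'a) algebra \<Rightarrow> ('a \<times> 'a) set \<Rightarrow>
    ('a \<times> 'a) set \<Rightarrow> ('f, ('a \<times> 'a) set) algebra" where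
  "kappa_image ar A \<alpha> \<gamma> =
     \<lparr>carrier = kappa ar A \<alpha> ` carrier (con_alg A \<gamma>),
      oper = oper (quot_alg (con_alg A \<alpha>) (Delta ar A \<alpha>))\<rparr>"

definition schur_multiplier :: "('f \<Rightarrow> nat) \<Rightarrow> ('f, 'a) algebra \<Rightarrow> ('a \<times> 'a) set \<Rightarrow>
    ('f, ('a set \<times> 'a set) set) algebra" where
  "schur_multiplier ar F \<theta> =
     (let \<delta> = commutator ar F \<theta> (top_con F)
      in kappa_image ar (quot_alg F \<delta>)
           (quot_con \<theta> \<delta>)
           (quot_con (\<theta> \<inter> commutator ar F (top_con F) (top_con F)) \<delta>))"

definition free_presentation :: "('f \<Rightarrow> nat) \<Rightarrow> 'f identities \<Rightarrow> ('f, 'a) algebra \<Rightarrow>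
    ('a \<times> 'a) set \<Rightarrow> ('f, 'q) algebra \<Rightarrow> bool" where
  "free_presentation ar E F \<theta> Q \<longleftrightarrow>
     free_algebra ar E F \<and> congruence ar F \<theta> \<and> isomorphic ar (quot_alg F \<theta>) Q"

end

theory Submission
  imports Defs
begin

text \<open>
  Liftings \<open>f : F \<rightarrow> G\<close> and \<open>g : G \<rightarrow> F\<close> of the identity of \<open>Q\<close> induce homomorphisms of
  the Schur multipliers, and \<open>g \<circ> f\<close> moves elements only within their \<open>\<alpha>\<close>-classes, so the
  claim is that an endomorphism \<open>h\<close> with \<open>(x, h x) \<in> \<alpha>\<close> induces the identity.
  Modulo \<open>[\<alpha>,1]\<close> the congruence \<open>\<alpha>\<close> is central, and \<open>(a, b) \<Delta> (c, d)\<close> means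
  \<open>d = m(b, a, c)\<close>, that is, ``\<open>b - a = d - c\<close>''. The ``difference'' of \<open>h x\<close> and \<open>x\<close> is a
  homomorphism to the abelian algebra \<open>A(\<alpha>)/\<Delta>\<close>, hence constant on \<open>[1,1]\<close>-classes:
  \<open>h x - x = h y - y\<close>. By commutativity \<open>y - x = h y - h x\<close>, so \<open>(x, y) \<Delta> (h x, h y)\<close>.
\<close>

section \<open>Homomorphisms, congruences and quotients\<close>

text \<open>The law \<open>m(x, y, y) = x\<close> is at hand only for
  \<open>\<alpha>\<close>-related \<open>x\<close>, \<open>y\<close>, so \<open>m\<close> need not
  be a Mal'cev operation. It comes from \<open>[\<alpha>,\<alpha>] \<le> [\<alpha>,1]\<close>, and
  the latter becomes trivial only after dividing by it; hence the quotient precedes every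
  calculation. The working tool is then the term condition with the
  \<open>\<alpha>\<close>-variables in the first block: an identity between polynomials is checked
  where one block is collapsed to a value at which both sides are evident, and is carried over from
  there. The liftings \<open>f\<close> and \<open>g\<close> come from projectivity of free algebras;
  they need be neither unique nor onto, so all induced maps are built for arbitrary homomorphisms. A
  second obstacle is one of types: freeness and the difference term are tested on algebras over a
  single carrier type. Both properties reach arbitrary types through generated subalgebras, copied
  onto sets of terms.\<close>

lemma eval_tm_in_carrier:
  assumes "is_algebra ar A" and "wf_tm ar t" and "\<And>v. \<rho> v \<in> carrier A"
  shows "eval_tm A \<rho> t \<in> carrier A"
  using assms(2)
proof induction
  case (2 ts f)
  then have "set (map (eval_tm A \<rho>) ts) \<subseteq> carrier A" by auto
  with 2 assms(1) show ?case by (simp add: is_algebra_def)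
qed (use assms in auto)

lemma eval_tm_hom:
  assumes "is_algebra ar A" and "is_hom ar A B h" and "wf_tm ar t"
    and "\<And>v. \<rho> v \<in> carrier A"
  shows "h (eval_tm A \<rho> t) = eval_tm B (\<lambda>v. h (\<rho> v)) t"
  using assms(3)
proof induction
  case (2 ts f)
  have "set (map (eval_tm A \<rho>) ts) \<subseteq> carrier A"
    using eval_tm_in_carrier[where \<rho> = \<rho>, OF assms(1) _ assms(4)] 2 by auto
  with 2 assms(2) have "h (eval_tm A \<rho> (App f ts)) = oper B f (map h (map (eval_tm A \<rho>) ts))"
    by (simp add: is_hom_def)
  also have "map h (map (eval_tm A \<rho>) ts) = map (eval_tm B (\<lambda>v. h (\<rho> v))) ts"
    using 2 by simp
  finally show ?case by simp
qed simp

lemma eval_tm_congruence: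
  assumes "congruence ar A \<theta>" and "wf_tm ar t" and "\<And>v. (\<rho> v, \<sigma> v) \<in> \<theta>"
  shows "(eval_tm A \<rho> t, eval_tm A \<sigma> t) \<in> \<theta>"
  using assms(2)
proof induction
  case (2 ts f)
  then have "list_all2 (\<lambda>x y. (x, y) \<in> \<theta>) (map (eval_tm A \<rho>) ts) (map (eval_tm A \<sigma>) ts)"
    by (auto simp: list_all2_conv_all_nth)
  with 2 assms(1) show ?case by (simp add: congruence_def)
qed (use assms in auto)

lemma is_hom_comp:
  assumes "is_hom ar A B h" and "is_hom ar B C k"
  shows "is_hom ar A C (\<lambda>x. k (h x))"
proof -
  have "map k (map h xs) = map (\<lambda>x. k (h x)) xs" for xs by simp
  moreover have "set (map h xs) \<subseteq> carrier B" if "set xs \<subseteq> carrier A" for xs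
    using that assms(1) by (auto simp: is_hom_def)
  ultimately show ?thesis
    using assms unfolding is_hom_def by (metis length_map)
qed

lemma in_variety_image:
  assumes "in_variety ar E A" and "wf_identities ar E" and "is_algebra ar B"
    and h: "is_hom ar A B h" and onto: "carrier B \<subseteq> h ` carrier A"
  shows "in_variety ar E B"
  unfolding in_variety_def
proof (intro conjI, fact, clarify)
  fix s t and \<rho> :: "nat \<Rightarrow> _" assume st: "(s, t) \<in> E" and \<rho>: "range \<rho> \<subseteq> carrier B"
  have "\<forall>v. \<exists>x. x \<in> carrier A \<and> h x = \<rho> v" using onto \<rho> by (metis imageE range_subsetD subset_iff)
  then obtain \<sigma> where \<sigma>: "\<And>v. \<sigma> v \<in> carrier A" "\<And>v. h (\<sigma> v) = \<rho> v" by metis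
  have wf: "wf_tm ar s" "wf_tm ar t" using assms(2) st by (auto simp: wf_identities_def)
  have A: "is_algebra ar A" "eval_tm A \<sigma> s = eval_tm A \<sigma> t"
    using assms(1) st \<sigma> unfolding in_variety_def by blast+
  show "eval_tm B \<rho> s = eval_tm B \<rho> t"
    using eval_tm_hom[where \<rho> = \<sigma>, OF A(1) h wf(1) \<sigma>(1)]
      eval_tm_hom[where \<rho> = \<sigma>, OF A(1) h wf(2) \<sigma>(1)] A(2) \<sigma>(2) by simp
qed

lemma in_variety_embedded:
  assumes "in_variety ar E A" and "wf_identities ar E" and B: "is_algebra ar B"
    and h: "is_hom ar B A h" and inj: "inj_on h (carrier B)"
  shows "in_variety ar E B"
  unfolding in_variety_def
proof (intro conjI, fact, clarify)
  fix s t and \<rho> :: "nat \<Rightarrow> _" assume st: "(s, t) \<in> E" and "range \<rho> \<subseteq> carrier B"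
  then have \<rho>: "\<And>v. \<rho> v \<in> carrier B" by auto
  have wf: "wf_tm ar s" "wf_tm ar t" using assms(2) st by (auto simp: wf_identities_def)
  have "range (\<lambda>v. h (\<rho> v)) \<subseteq> carrier A" using h \<rho> by (auto simp: is_hom_def)
  then have "eval_tm A (\<lambda>v. h (\<rho> v)) s = eval_tm A (\<lambda>v. h (\<rho> v)) t"
    using assms(1) st unfolding in_variety_def by blast
  then have "h (eval_tm B \<rho> s) = h (eval_tm B \<rho> t)"
    using eval_tm_hom[where \<rho> = \<rho>, OF B h wf(1) \<rho>] eval_tm_hom[where \<rho> = \<rho>, OF B h wf(2) \<rho>] by simp
  then show "eval_tm B \<rho> s = eval_tm B \<rho> t"
    using inj eval_tm_in_carrier[where \<rho> = \<rho>, OF B wf(1) \<rho>]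
      eval_tm_in_carrier[where \<rho> = \<rho>, OF B wf(2) \<rho>]
    by (auto dest: inj_onD)
qed

section \<open>Congruences and their preimages\<close>

lemma congruence_Inter:
  assumes "\<Theta> \<noteq> {}" and "\<And>\<theta>. \<theta> \<in> \<Theta> \<Longrightarrow> congruence ar A \<theta>"
  shows "congruence ar A (\<Inter>\<Theta>)"
  unfolding congruence_def
proof (intro conjI allI impI)
  have eq: "\<And>\<theta>. \<theta> \<in> \<Theta> \<Longrightarrow> equiv (carrier A) \<theta>"
    using assms(2) by (simp add: congruence_def)
  show "equiv (carrier A) (\<Inter>\<Theta>)"
  proof (rule equivI)
    show "\<Inter>\<Theta> \<subseteq> carrier A \<times> carrier A"
      using eq assms(1) equiv_type by blast
    show "refl_on (carrier A) (\<Inter>\<Theta>)"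
      using eq by (auto simp: equiv_def refl_on_def)
    show "sym (\<Inter>\<Theta>)"
      using eq by (auto simp: equiv_def sym_def)
    show "trans (\<Inter>\<Theta>)"
      using eq unfolding equiv_def trans_def by blast
  qed
  fix f xs ys
  assume xy: "length xs = ar f \<and> list_all2 (\<lambda>x y. (x, y) \<in> \<Inter>\<Theta>) xs ys"
  show "(oper A f xs, oper A f ys) \<in> \<Inter>\<Theta>"
  proof
    fix \<theta> assume \<theta>: "\<theta> \<in> \<Theta>"
    have "list_all2 (\<lambda>x y. (x, y) \<in> \<theta>) xs ys"
      using xy \<theta> by (auto simp: list_all2_conv_all_nth)
    with assms(2)[OF \<theta>] xy show "(oper A f xs, oper A f ys) \<in> \<theta>"
      by (simp add: congruence_def)
  qed
qed

lemma list_all2_set_subset: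
  assumes "list_all2 (\<lambda>x y. (x, y) \<in> \<theta>) xs ys" and "\<theta> \<subseteq> S \<times> T"
  shows "set xs \<subseteq> S" "set ys \<subseteq> T"
proof -
  have "(xs ! i, ys ! i) \<in> S \<times> T" if "i < length xs" for i
    using assms that by (auto simp: list_all2_conv_all_nth)
  moreover have "length ys = length xs" using assms(1) by (simp add: list_all2_lengthD)
  ultimately show "set xs \<subseteq> S" "set ys \<subseteq> T" by (fastforce simp: in_set_conv_nth)+
qed

lemma congruence_top: "is_algebra ar A \<Longrightarrow> congruence ar A (top_con A)"
  unfolding congruence_def top_con_def
proof (intro conjI allI impI)
  show "equiv (carrier A) (carrier A \<times> carrier A)"
    by (rule equivI) (auto simp: refl_on_def sym_def trans_def)
next
  fix f xs ys assume A: "is_algebra ar A"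
    and *: "length xs = ar f \<and> list_all2 (\<lambda>x y. (x, y) \<in> carrier A \<times> carrier A) xs ys"
  then have "length ys = ar f" "set xs \<subseteq> carrier A" "set ys \<subseteq> carrier A"
    using list_all2_set_subset[of "carrier A \<times> carrier A" xs ys "carrier A" "carrier A"]
    by (auto dest: list_all2_lengthD)
  with A * show "(oper A f xs, oper A f ys) \<in> carrier A \<times> carrier A"
    by (simp add: is_algebra_def)
qed

text \<open>\<open>\<alpha> \<subseteq> pullback A h \<beta>\<close> is the form in which
  "\<open>h\<close> carries \<open>\<alpha>\<close> into \<open>\<beta>\<close>" is used below, and
  \<open>pullback A h Id\<close> is the kernel of \<open>h\<close>. The carrier conditions are
  needed because \<open>h\<close> is total on the type.\<close>

definition pullback :: "('f, 'a) algebra \<Rightarrow> ('a \<Rightarrow> 'b) \<Rightarrow> ('b \<times> 'b) set \<Rightarrow> ('a \<times> 'a) set" where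
  "pullback A h \<theta> = {(x, y). x \<in> carrier A \<and> y \<in> carrier A \<and> (h x, h y) \<in> \<theta>}"

lemma congruence_pullback:
  assumes "is_algebra ar A" and h: "is_hom ar A B h" and \<theta>: "congruence ar B \<theta>"
  shows "congruence ar A (pullback A h \<theta>)"
  unfolding congruence_def
proof (intro conjI allI impI)
  have eq: "equiv (carrier B) \<theta>" using \<theta> by (simp add: congruence_def)
  show "equiv (carrier A) (pullback A h \<theta>)"
  proof (rule equivI)
    show "pullback A h \<theta> \<subseteq> carrier A \<times> carrier A" by (auto simp: pullback_def)
    show "refl_on (carrier A) (pullback A h \<theta>)"
      using eq h by (auto simp: pullback_def equiv_def refl_on_def is_hom_def)
    show "sym (pullback A h \<theta>)"
      using eq by (auto simp: pullback_def equiv_def sym_def)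
    show "trans (pullback A h \<theta>)"
      using eq unfolding pullback_def equiv_def trans_def by blast
  qed
  fix f xs ys
  assume xy: "length xs = ar f \<and> list_all2 (\<lambda>x y. (x, y) \<in> pullback A h \<theta>) xs ys"
  then have sub: "set xs \<subseteq> carrier A" "set ys \<subseteq> carrier A" "length ys = ar f"
    using list_all2_set_subset[of "pullback A h \<theta>" xs ys "carrier A" "carrier A"]
    by (auto simp: pullback_def dest: list_all2_lengthD)
  have "list_all2 (\<lambda>x y. (x, y) \<in> \<theta>) (map h xs) (map h ys)"
    using xy by (auto simp: list_all2_conv_all_nth pullback_def)
  then have "(oper B f (map h xs), oper B f (map h ys)) \<in> \<theta>"
    using \<theta> xy by (simp add: congruence_def)
  with sub xy h assms(1) show "(oper A f xs, oper A f ys) \<in> pullback A h \<theta>"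
    by (simp add: pullback_def is_hom_def is_algebra_def)
qed

lemma congruence_subset: "congruence ar A \<theta> \<Longrightarrow> \<theta> \<subseteq> carrier A \<times> carrier A"
  by (simp add: congruence_def equiv_type)

lemma congruence_refl: "congruence ar A \<theta> \<Longrightarrow> x \<in> carrier A \<Longrightarrow> (x, x) \<in> \<theta>"
  by (simp add: congruence_def equiv_def refl_on_def)

lemma congruence_sym: "congruence ar A \<theta> \<Longrightarrow> (x, y) \<in> \<theta> \<Longrightarrow> (y, x) \<in> \<theta>"
  by (auto simp: congruence_def equiv_def dest: symD)

lemma congruence_trans: "congruence ar A \<theta> \<Longrightarrow> (x, y) \<in> \<theta> \<Longrightarrow> (y, z) \<in> \<theta> \<Longrightarrow> (x, z) \<in> \<theta>"
  unfolding congruence_def equiv_def by (elim conjE) (rule transD)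

lemma congruence_class_eq:
  assumes "congruence ar A \<theta>" and "x \<in> carrier A" and "y \<in> carrier A"
  shows "\<theta> `` {x} = \<theta> `` {y} \<longleftrightarrow> (x, y) \<in> \<theta>"
  using eq_equiv_class_iff[OF _ assms(2,3)] assms(1) by (simp only: congruence_def)

section \<open>The term condition and the commutator\<close>

lemma centralizesD:
  fixes t :: "('f, nat + nat) tm"
  assumes "centralizes ar A \<alpha> \<beta> \<delta>" and "wf_tm ar t"
    and "\<And>i. (a i, b i) \<in> \<alpha>" and "\<And>j. (c j, d j) \<in> \<beta>"
    and "(eval_tm A (case_sum a c) t, eval_tm A (case_sum a d) t) \<in> \<delta>"
  shows "(eval_tm A (case_sum b c) t, eval_tm A (case_sum b d) t) \<in> \<delta>"
  using assms(1)[unfolded centralizes_def, rule_format, of t a b c d] assms(2-) by simp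

lemma centralizes_top:
  fixes A :: "('f, 'a) algebra"
  assumes A: "is_algebra ar A" and \<alpha>: "\<alpha> \<subseteq> top_con A" and \<beta>: "\<beta> \<subseteq> top_con A"
  shows "centralizes ar A \<alpha> \<beta> (top_con A)"
  unfolding centralizes_def
proof (intro allI impI)
  fix t :: "('f, nat + nat) tm" and a b c d
  assume H: "wf_tm ar t \<and> (\<forall>i. (a i, b i) \<in> \<alpha>) \<and> (\<forall>j. (c j, d j) \<in> \<beta>) \<and>
      (eval_tm A (case_sum a c) t, eval_tm A (case_sum a d) t) \<in> top_con A"
  then have "\<And>i. b i \<in> carrier A" "\<And>i. c i \<in> carrier A" "\<And>i. d i \<in> carrier A"
    using \<alpha> \<beta> by (auto simp: top_con_def)
  then show "(eval_tm A (case_sum b c) t, eval_tm A (case_sum b d) t) \<in> top_con A"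
    using H by (auto simp: top_con_def intro!: eval_tm_in_carrier[OF A] split: sum.split)
qed

text \<open>Holds for homomorphisms that are not onto, because preimages of congruences satisfying the
  term condition satisfy it again.\<close>

lemma commutator_hom:
  fixes A :: "('f, 'a) algebra" and B :: "('f, 'b) algebra"
  assumes A: "is_algebra ar A" and h: "is_hom ar A B h"
    and \<alpha>: "\<alpha> \<subseteq> pullback A h \<alpha>'" and \<beta>: "\<beta> \<subseteq> pullback A h \<beta>'"
  shows "commutator ar A \<alpha> \<beta> \<subseteq> pullback A h (commutator ar B \<alpha>' \<beta>')"
proof -
  have *: "commutator ar A \<alpha> \<beta> \<subseteq> pullback A h \<delta>"
    if \<delta>: "congruence ar B \<delta>" "centralizes ar B \<alpha>' \<beta>' \<delta>" for \<delta>
  proof -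
    have "centralizes ar A \<alpha> \<beta> (pullback A h \<delta>)"
      unfolding centralizes_def
    proof (intro allI impI)
      fix t :: "('f, nat + nat) tm" and a b c d
      assume H: "wf_tm ar t \<and> (\<forall>i. (a i, b i) \<in> \<alpha>) \<and> (\<forall>j. (c j, d j) \<in> \<beta>) \<and>
        (eval_tm A (case_sum a c) t, eval_tm A (case_sum a d) t) \<in> pullback A h \<delta>"
      have ab: "a i \<in> carrier A" "b i \<in> carrier A" "(h (a i), h (b i)) \<in> \<alpha>'" for i
        using H \<alpha> by (auto simp: pullback_def)
      have cd: "c i \<in> carrier A" "d i \<in> carrier A" "(h (c i), h (d i)) \<in> \<beta>'" for i
        using H \<beta> by (auto simp: pullback_def)
      have ev: "eval_tm A (case_sum p q) t \<in> carrier A"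
        "h (eval_tm A (case_sum p q) t) = eval_tm B (case_sum (\<lambda>i. h (p i)) (\<lambda>i. h (q i))) t"
        if "\<And>i. p i \<in> carrier A" "\<And>i. q i \<in> carrier A" for p q
      proof -
        have \<rho>: "case_sum p q v \<in> carrier A" for v using that by (cases v) auto
        have "(\<lambda>v. h (case_sum p q v)) = case_sum (\<lambda>i. h (p i)) (\<lambda>i. h (q i))"
          by (auto simp: fun_eq_iff split: sum.split)
        with \<rho> H show "eval_tm A (case_sum p q) t \<in> carrier A"
          "h (eval_tm A (case_sum p q) t) = eval_tm B (case_sum (\<lambda>i. h (p i)) (\<lambda>i. h (q i))) t"
          using eval_tm_in_carrier[OF A, of t "case_sum p q"] eval_tm_hom[OF A h, of t "case_sum p q"]
          by auto
      qed
      have "(eval_tm B (case_sum (\<lambda>i. h (a i)) (\<lambda>i. h (c i))) t,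
             eval_tm B (case_sum (\<lambda>i. h (a i)) (\<lambda>i. h (d i))) t) \<in> \<delta>"
        using H ev ab cd by (auto simp: pullback_def)
      then have "(eval_tm B (case_sum (\<lambda>i. h (b i)) (\<lambda>i. h (c i))) t,
             eval_tm B (case_sum (\<lambda>i. h (b i)) (\<lambda>i. h (d i))) t) \<in> \<delta>"
        using H by (intro centralizesD[OF \<delta>(2) _ ab(3) cd(3)]) auto
      then show "(eval_tm A (case_sum b c) t, eval_tm A (case_sum b d) t) \<in> pullback A h \<delta>"
        using ev ab cd by (simp add: pullback_def)
    qed
    with congruence_pullback[OF A h \<delta>(1)] show ?thesis
      by (auto simp: commutator_def)
  qed
  \<comment> \<open>The carrier part of \<open>pullback\<close> is obtained inside \<open>A\<close>,
    independently of whether any \<open>\<delta>\<close> on \<open>B\<close> exists to which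
    \<open>*\<close> could be applied.\<close>
  have "congruence ar A (top_con A)" by (rule congruence_top[OF A])
  moreover have "centralizes ar A \<alpha> \<beta> (top_con A)"
    using \<alpha> \<beta> by (intro centralizes_top[OF A]) (auto simp: pullback_def top_con_def)
  ultimately have "commutator ar A \<alpha> \<beta> \<subseteq> carrier A \<times> carrier A"
    by (auto simp: commutator_def top_con_def)
  with * show ?thesis
    unfolding commutator_def[of ar B] by (fastforce simp: pullback_def)
qed

text \<open>The term condition survives intersections in its third argument, so the commutator is
  itself the least member of the family that defines it. The top congruence shows that this family
  is nonempty.\<close>

lemma
  fixes A :: "('f, 'a) algebra"
  assumes A: "is_algebra ar A" and \<alpha>: "\<alpha> \<subseteq> top_con A" and \<beta>: "\<beta> \<subseteq> top_con A"
  shows congruence_commutator: "congruence ar A (commutator ar A \<alpha> \<beta>)"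
    and centralizes_commutator: "centralizes ar A \<alpha> \<beta> (commutator ar A \<alpha> \<beta>)"
proof -
  have "centralizes ar A \<alpha> \<beta> (top_con A)" using assms by (rule centralizes_top)
  then have "top_con A \<in> {\<delta>. congruence ar A \<delta> \<and> centralizes ar A \<alpha> \<beta> \<delta>}"
    using congruence_top[OF A] by simp
  then show "congruence ar A (commutator ar A \<alpha> \<beta>)"
    unfolding commutator_def by (intro congruence_Inter) auto
  show "centralizes ar A \<alpha> \<beta> (commutator ar A \<alpha> \<beta>)"
    unfolding centralizes_def
  proof (intro allI impI)
    fix t :: "('f, nat + nat) tm" and a b c d
    assume H: "wf_tm ar t \<and> (\<forall>i. (a i, b i) \<in> \<alpha>) \<and> (\<forall>j. (c j, d j) \<in> \<beta>) \<and>
        (eval_tm A (case_sum a c) t, eval_tm A (case_sum a d) t) \<in> commutator ar A \<alpha> \<beta>"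
    show "(eval_tm A (case_sum b c) t, eval_tm A (case_sum b d) t) \<in> commutator ar A \<alpha> \<beta>"
      unfolding commutator_def
    proof (clarify)
      fix \<delta> assume \<delta>: "congruence ar A \<delta>" "centralizes ar A \<alpha> \<beta> \<delta>"
      then have "(eval_tm A (case_sum a c) t, eval_tm A (case_sum a d) t) \<in> \<delta>"
        using H by (auto simp: commutator_def)
      with H show "(eval_tm A (case_sum b c) t, eval_tm A (case_sum b d) t) \<in> \<delta>"
        using centralizesD[OF \<delta>(2)] by blast
    qed
  qed
qed

section \<open>Quotient algebras and induced maps\<close>

lemma oper_quot_alg:
  assumes \<theta>: "congruence ar A \<theta>" and "length xs = ar f" and "set xs \<subseteq> carrier A"
  shows "oper (quot_alg A \<theta>) f (map (\<lambda>x. \<theta> `` {x}) xs) = \<theta> `` {oper A f xs}"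
proof -
  have eq: "equiv (carrier A) \<theta>" using \<theta> by (simp add: congruence_def)
  \<comment> \<open>\<open>quot_alg\<close> saturates the set of values over all choices of
    representatives: \<open>rel\<close> puts these values into one class, and \<open>self\<close>
    provides at least one of them.\<close>
  have rel: "(oper A f xs, oper A f ys) \<in> \<theta>" if "list_all2 (\<in>) ys (map (\<lambda>x. \<theta> `` {x}) xs)" for ys
  proof -
    have "list_all2 (\<lambda>x y. (x, y) \<in> \<theta>) xs ys"
      using that by (auto simp: list_all2_conv_all_nth)
    with \<theta> assms(2) show ?thesis by (simp add: congruence_def)
  qed
  have self: "list_all2 (\<in>) xs (map (\<lambda>x. \<theta> `` {x}) xs)"
    using assms(3) congruence_refl[OF \<theta>] nth_mem by (fastforce simp: list_all2_conv_all_nth)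
  have "\<theta> `` {oper A f ys | ys. list_all2 (\<in>) ys (map (\<lambda>x. \<theta> `` {x}) xs)} = \<theta> `` {oper A f xs}"
    (is "?L = ?R")
  proof
    show "?L \<subseteq> ?R" using rel congruence_trans[OF \<theta>] by blast
    show "?R \<subseteq> ?L" using self by blast
  qed
  then show ?thesis by (simp add: quot_alg_def)
qed

lemma carrier_quot_list:
  assumes "set Xs \<subseteq> carrier (quot_alg A \<theta>)"
  obtains xs where "set xs \<subseteq> carrier A" and "Xs = map (\<lambda>x. \<theta> `` {x}) xs"
proof -
  have "\<exists>xs. set xs \<subseteq> carrier A \<and> Xs = map (\<lambda>x. \<theta> `` {x}) xs"
    using assms
  proof (induction Xs)
    case (Cons X Xs)
    then obtain xs x where "set (x # xs) \<subseteq> carrier A" "X # Xs = map (\<lambda>x. \<theta> `` {x}) (x # xs)"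
      by (auto simp: quot_alg_def elim!: quotientE)
    then show ?case by (intro exI[of _ "x # xs"] conjI)
  qed simp
  with that show thesis by blast
qed

lemma is_algebra_quot_alg:
  assumes "is_algebra ar A" and "congruence ar A \<theta>"
  shows "is_algebra ar (quot_alg A \<theta>)"
  unfolding is_algebra_def
proof (intro conjI allI impI)
  show "carrier (quot_alg A \<theta>) \<noteq> {}"
    using assms(1) by (auto simp: quot_alg_def is_algebra_def quotient_def)
  fix f Xs assume Xs: "length Xs = ar f \<and> set Xs \<subseteq> carrier (quot_alg A \<theta>)"
  then obtain xs where xs: "set xs \<subseteq> carrier A" "Xs = map (\<lambda>x. \<theta> `` {x}) xs"
    using carrier_quot_list by blast
  have "oper A f xs \<in> carrier A" using assms(1) xs Xs by (simp add: is_algebra_def)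
  then show "oper (quot_alg A \<theta>) f Xs \<in> carrier (quot_alg A \<theta>)"
    using oper_quot_alg[OF assms(2), of xs f] xs Xs by (simp add: quot_alg_def quotientI)
qed

lemma is_hom_quot_proj:
  assumes "congruence ar A \<theta>"
  shows "is_hom ar A (quot_alg A \<theta>) (\<lambda>x. \<theta> `` {x})"
  unfolding is_hom_def
proof (intro conjI allI ballI impI)
  show "\<theta> `` {x} \<in> carrier (quot_alg A \<theta>)" if "x \<in> carrier A" for x
    using that by (simp add: quot_alg_def quotientI)
  show "\<theta> `` {oper A f xs} = oper (quot_alg A \<theta>) f (map (\<lambda>x. \<theta> `` {x}) xs)"
    if "length xs = ar f \<and> set xs \<subseteq> carrier A" for f xs
    using that oper_quot_alg[OF assms] by auto
qed

lemma in_variety_quot_alg: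
  assumes "in_variety ar E A" and "wf_identities ar E" and "congruence ar A \<theta>"
  shows "in_variety ar E (quot_alg A \<theta>)"
proof (rule in_variety_image[OF assms(1,2) _ is_hom_quot_proj[OF assms(3)]])
  show "is_algebra ar (quot_alg A \<theta>)"
    using assms(1,3) by (simp add: in_variety_def is_algebra_quot_alg)
  show "carrier (quot_alg A \<theta>) \<subseteq> (\<lambda>x. \<theta> `` {x}) ` carrier A"
    by (auto simp: quot_alg_def quotient_def)
qed

text \<open>This makes \<open>X \<mapsto> \<theta>'\<close> (h \<open>X)\<close> the induced map on
  classes, with no representative to be chosen.\<close>

lemma class_image:
  assumes "congruence ar A \<theta>" and "congruence ar B \<theta>'" and "\<theta> \<subseteq> pullback A h \<theta>'"
    and "x \<in> carrier A"
  shows "\<theta>' `` (h ` (\<theta> `` {x})) = \<theta>' `` {h x}"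
proof
  show "\<theta>' `` {h x} \<subseteq> \<theta>' `` (h ` (\<theta> `` {x}))"
    using congruence_refl[OF assms(1,4)] by blast
  show "\<theta>' `` (h ` (\<theta> `` {x})) \<subseteq> \<theta>' `` {h x}"
  proof clarsimp
    fix y z assume "(x, z) \<in> \<theta>" and "(h z, y) \<in> \<theta>'"
    then show "(h x, y) \<in> \<theta>'"
      using assms(3) congruence_trans[OF assms(2)] by (auto simp: pullback_def)
  qed
qed

lemma is_hom_quot_map:
  assumes A: "is_algebra ar A" and \<theta>: "congruence ar A \<theta>" "congruence ar B \<theta>'"
    and h: "is_hom ar A B h" and sub: "\<theta> \<subseteq> pullback A h \<theta>'"
  shows "is_hom ar (quot_alg A \<theta>) (quot_alg B \<theta>') (\<lambda>X. \<theta>' `` (h ` X))"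
  unfolding is_hom_def
proof (intro conjI allI ballI impI)
  note im = class_image[OF \<theta> sub]
  show "\<theta>' `` (h ` X) \<in> carrier (quot_alg B \<theta>')" if "X \<in> carrier (quot_alg A \<theta>)" for X
    using that im h by (auto simp: quot_alg_def is_hom_def elim!: quotientE intro!: quotientI)
  fix f Xs assume Xs: "length Xs = ar f \<and> set Xs \<subseteq> carrier (quot_alg A \<theta>)"
  then obtain xs where xs: "set xs \<subseteq> carrier A" "Xs = map (\<lambda>x. \<theta> `` {x}) xs"
    using carrier_quot_list by blast
  have maps: "map (\<lambda>X. \<theta>' `` (h ` X)) Xs = map (\<lambda>y. \<theta>' `` {y}) (map h xs)"
    unfolding xs(2) map_map comp_def using xs(1) im by (intro map_cong) blast+
  have "set (map h xs) \<subseteq> carrier B" "oper A f xs \<in> carrier A" "length xs = ar f"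
    using xs Xs h A by (auto simp: is_hom_def is_algebra_def)
  moreover have "h (oper A f xs) = oper B f (map h xs)"
    using xs Xs h by (simp add: is_hom_def)
  ultimately show "\<theta>' `` (h ` oper (quot_alg A \<theta>) f Xs)
      = oper (quot_alg B \<theta>') f (map (\<lambda>X. \<theta>' `` (h ` X)) Xs)"
    unfolding maps using oper_quot_alg[OF \<theta>(1), of xs f] oper_quot_alg[OF \<theta>(2), of "map h xs" f]
    using xs by (simp add: im)
qed

section \<open>Central congruences\<close>

lemma eval_tm_con_alg:
  "eval_tm (con_alg A \<alpha>) \<rho> t = (eval_tm A (\<lambda>v. fst (\<rho> v)) t, eval_tm A (\<lambda>v. snd (\<rho> v)) t)"
  by (induction t) (simp_all add: con_alg_def comp_def cong: map_cong)

text \<open>The situation reached after dividing by \<open>[\<alpha>,1]\<close>. Of the variety only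
  the two laws of \<open>m\<close> are kept; \<open>m_right\<close> is a genuine equality here
  because the commutator of a central congruence with itself is trivial.\<close>

locale central_congruence =
  fixes ar :: "'f \<Rightarrow> nat" and A :: "('f, 'a) algebra" and m :: 'f and \<alpha> :: "('a \<times> 'a) set"
  assumes alg: "is_algebra ar A"
    and ar_m: "ar m = 3"
    and m_left: "x \<in> carrier A \<Longrightarrow> y \<in> carrier A \<Longrightarrow> oper A m [x, x, y] = y"
    and con: "congruence ar A \<alpha>"
    and m_right: "(x, y) \<in> \<alpha> \<Longrightarrow> oper A m [x, y, y] = x"
    and central: "centralizes ar A \<alpha> (top_con A) Id"
begin

section \<open>Calculus of \<open>mo x y z\<close>, to be read as x - y + z\<close>

abbreviation mo :: "'a \<Rightarrow> 'a \<Rightarrow> 'a \<Rightarrow> 'a" where "mo x y z \<equiv> oper A m [x, y, z]"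

abbreviation Mt :: "('f, 'v) tm \<Rightarrow> ('f, 'v) tm \<Rightarrow> ('f, 'v) tm \<Rightarrow> ('f, 'v) tm" where
  "Mt s t u \<equiv> App m [s, t, u]"

lemma wf_Mt: "wf_tm ar s \<Longrightarrow> wf_tm ar t \<Longrightarrow> wf_tm ar u \<Longrightarrow> wf_tm ar (Mt s t u)"
  by (intro wf_tm.intros) (auto simp: ar_m)

lemma con_carrier: "(x, y) \<in> \<alpha> \<Longrightarrow> x \<in> carrier A" "(x, y) \<in> \<alpha> \<Longrightarrow> y \<in> carrier A"
  using congruence_subset[OF con] by auto

lemmas con_refl = congruence_refl[OF con]
lemmas con_sym = congruence_sym[OF con]
lemmas con_trans = congruence_trans[OF con]

lemma con_oper:
  "length xs = ar f \<Longrightarrow> list_all2 (\<lambda>x y. (x, y) \<in> \<alpha>) xs ys \<Longrightarrow> (oper A f xs, oper A f ys) \<in> \<alpha>"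
  using con by (simp add: congruence_def)

lemma con_mo:
  "(x, x') \<in> \<alpha> \<Longrightarrow> (y, y') \<in> \<alpha> \<Longrightarrow> (z, z') \<in> \<alpha> \<Longrightarrow> (mo x y z, mo x' y' z') \<in> \<alpha>"
  by (rule con_oper) (simp_all add: ar_m)

lemma con_mo_shift: "(b, a) \<in> \<alpha> \<Longrightarrow> c \<in> carrier A \<Longrightarrow> (mo b a c, c) \<in> \<alpha>"
  using con_mo[of b a a a c c] con_refl m_left[of a c] con_carrier[of b a] by simp

lemma term_condition:
  fixes t :: "('f, nat + nat) tm"
  assumes "wf_tm ar t" and "\<And>i. (a i, b i) \<in> \<alpha>"
    and "\<And>j. c j \<in> carrier A" and "\<And>j. d j \<in> carrier A"
    and "eval_tm A (case_sum a c) t = eval_tm A (case_sum a d) t"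
  shows "eval_tm A (case_sum b c) t = eval_tm A (case_sum b d) t"
  using centralizesD[OF central assms(1), of a b c d] assms(2-) by (simp add: top_con_def)

text \<open>A map agreeing with another one both where the \<open>\<alpha>\<close>-block and where the other block is
  collapsed agrees with it everywhere: apply the term condition to
  \<open>m(f(x,z), g(x,z), w)\<close> and then put \<open>w = g(x,z)\<close>.\<close>

lemma term_eqI:
  fixes s t :: "('f, nat + nat) tm"
  assumes wf: "wf_tm ar s" "wf_tm ar t" and ab: "\<And>i. (a i, b i) \<in> \<alpha>"
    and c: "\<And>j. c j \<in> carrier A" and d: "\<And>j. d j \<in> carrier A"
    and ac: "eval_tm A (case_sum a c) s = eval_tm A (case_sum a c) t"
    and ad: "eval_tm A (case_sum a d) s = eval_tm A (case_sum a d) t"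
    and bc: "eval_tm A (case_sum b c) s = eval_tm A (case_sum b c) t"
  shows "eval_tm A (case_sum b d) s = eval_tm A (case_sum b d) t"
proof -
  \<comment> \<open>Shifting the second block by \<open>Suc\<close> frees \<open>Inr 0\<close> for
    the additional variable \<open>w\<close>.\<close>
  let ?sh = "\<lambda>v. case v of Inl i \<Rightarrow> Inl i | Inr j \<Rightarrow> Inr (Suc j)"
  let ?w = "eval_tm A (case_sum b d) t"
  let ?r = "Mt (map_tm id ?sh s) (map_tm id ?sh t) (Var (Inr 0))"
  have shift: "eval_tm A (case_sum p (case_nat w q)) (map_tm id ?sh r) = eval_tm A (case_sum p q) r"
    for p q w and r :: "('f, nat + nat) tm"
    by (induction r) (auto simp: comp_def cong: map_cong split: sum.split)
  have wf_shift: "wf_tm ar (map_tm id ?sh r)" if "wf_tm ar r" for r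
    using that by induction (auto intro!: wf_tm.intros)
  have a: "a i \<in> carrier A" and b: "b i \<in> carrier A" for i
    using ab con_carrier by blast+
  have ev: "eval_tm A (case_sum p q) r \<in> carrier A"
    if "wf_tm ar r" "\<And>i. p i \<in> carrier A" "\<And>i. q i \<in> carrier A"
    for p q and r :: "('f, nat + nat) tm"
    using that by (intro eval_tm_in_carrier[OF alg]) (auto split: sum.split)
  have w: "?w \<in> carrier A" using wf b d by (intro ev)
  have wf_r: "wf_tm ar ?r" by (intro wf_Mt wf_shift wf wf_tm.intros)
  have "eval_tm A (case_sum b (case_nat ?w c)) ?r = eval_tm A (case_sum b (case_nat ?w d)) ?r"
    using wf_r
  proof (rule term_condition)
    show "(a i, b i) \<in> \<alpha>" for i by fact
    show "case_nat ?w c j \<in> carrier A" "case_nat ?w d j \<in> carrier A" for j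
      using c d w by (auto split: nat.split)
    show "eval_tm A (case_sum a (case_nat ?w c)) ?r = eval_tm A (case_sum a (case_nat ?w d)) ?r"
      using ac ad w ev[OF wf(2) a c] ev[OF wf(2) a d] by (simp add: shift m_left)
  qed
  then have "mo (eval_tm A (case_sum b d) s) ?w ?w = ?w"
    using bc w ev[OF wf(2) b c] by (simp add: shift m_left)
  \<comment> \<open>\<open>m_right\<close> cancels only inside an \<open>\<alpha>\<close>-class. The
    chain is s(b,d) \<open>\<alpha>\<close> s(a,d) = t(a,d) \<open>\<alpha>\<close> t(b,d).\<close>
  moreover have "(eval_tm A (case_sum b d) s, ?w) \<in> \<alpha>"
  proof -
    have "(eval_tm A (case_sum a d) r, eval_tm A (case_sum b d) r) \<in> \<alpha>"
      if "wf_tm ar r" for r :: "('f, nat + nat) tm"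
      using that ab d con_refl by (intro eval_tm_congruence[OF con]) (auto split: sum.split)
    from this[OF wf(1)] this[OF wf(2)] show ?thesis
      using ad con_sym con_trans by metis
  qed
  ultimately show ?thesis using m_right by simp
qed

text \<open>In m(m(x,a,y),y,e) put x = a: the value is e, for y = c as well as for y = a. The term
  condition moves x from a to b, and at y = a the value is m(b,a,e).\<close>

lemma mo_trans:
  assumes "(b, a) \<in> \<alpha>" and "c \<in> carrier A" and "e \<in> carrier A"
  shows "mo (mo b a c) c e = mo b a e"
proof -
  let ?t = "Mt (Mt (Var (Inl 0)) (Var (Inr 0)) (Var (Inr 1))) (Var (Inr 1)) (Var (Inr 2))
    :: ('f, nat + nat) tm"
  let ?v = "\<lambda>x j. if j = (0::nat) then a else if j = 1 then x else e"
  have "eval_tm A (case_sum (\<lambda>_. b) (?v c)) ?t = eval_tm A (case_sum (\<lambda>_. b) (?v a)) ?t"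
    by (rule term_condition[where a = "\<lambda>_. a"])
      (use assms con_carrier[OF assms(1)] con_sym m_left ar_m in \<open>auto intro!: wf_Mt wf_tm.intros\<close>)
  then show ?thesis using assms m_right by simp
qed

text \<open>With \<open>q\<close> collapsed to \<open>e\<close> both sides are \<open>r\<close>, and
  with \<open>r\<close> collapsed to \<open>e\<close> both are \<open>q\<close>. This uses
  \<open>m_right\<close>, so all three elements must share an \<open>\<alpha>\<close>-class.\<close>

lemma mo_commute:
  assumes q: "(q, e) \<in> \<alpha>" and r: "(r, e) \<in> \<alpha>"
  shows "mo q e r = mo r e q"
proof -
  let ?s = "Mt (Var (Inl 0)) (Var (Inr 0)) (Var (Inr 1)) :: ('f, nat + nat) tm"
  let ?t = "Mt (Var (Inr 1)) (Var (Inr 0)) (Var (Inl 0)) :: ('f, nat + nat) tm"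
  let ?v = "\<lambda>x j. if j = (0::nat) then e else x"
  have "eval_tm A (case_sum (\<lambda>_. q) (?v r)) ?s = eval_tm A (case_sum (\<lambda>_. q) (?v r)) ?t"
    by (rule term_eqI[where a = "\<lambda>_. e" and c = "?v e"])
      (use q r con_carrier[OF q] con_carrier[OF r] con_sym m_left m_right ar_m
       in \<open>auto intro!: wf_Mt wf_tm.intros\<close>)
  then show ?thesis by simp
qed

text \<open>By \<open>term_eqI\<close> it suffices to compare the sides after replacing
  \<open>bs\<close> by \<open>as\<close> or \<open>cs\<close> by \<open>as\<close>. The first
  replacement leaves the value of \<open>f\<close> at the third list, by \<open>m_left\<close>; the
  second leaves its value at the first list, by \<open>m_right\<close>.\<close>

lemma mo_oper:
  assumes len: "length as = ar f" and ba: "list_all2 (\<lambda>x y. (x, y) \<in> \<alpha>) bs as"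
    and cs: "length cs = ar f" "set cs \<subseteq> carrier A"
  shows "mo (oper A f bs) (oper A f as) (oper A f cs)
    = oper A f (map (\<lambda>i. mo (bs ! i) (as ! i) (cs ! i)) [0..<ar f])"
proof -
  let ?n = "ar f"
  obtain u where u: "u \<in> carrier A" using alg by (auto simp: is_algebra_def)
  let ?s = "Mt (App f (map (\<lambda>i. Var (Inl i)) [0..<?n])) (App f (map (\<lambda>i. Var (Inr i)) [0..<?n]))
    (App f (map (\<lambda>i. Var (Inr (?n + i))) [0..<?n])) :: ('f, nat + nat) tm"
  let ?t = "App f (map (\<lambda>i. Mt (Var (Inl i)) (Var (Inr i)) (Var (Inr (?n + i)))) [0..<?n])
    :: ('f, nat + nat) tm"
  \<comment> \<open>The first block holds the list that varies between \<open>as\<close> and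
    \<open>bs\<close>. The second holds \<open>as\<close> in places 0 to n-1 and the list varying
    between \<open>as\<close> and \<open>cs\<close> in the next n. All remaining variables get the
    filler \<open>u\<close>, so that the assignments stay in the carrier.\<close>
  let ?l = "\<lambda>xs i. if i < ?n then xs ! i else u"
  let ?r = "\<lambda>xs i. if i < ?n then as ! i else if i < ?n + ?n then xs ! (i - ?n) else u"
  have lb: "length bs = ?n" using ba len by (simp add: list_all2_lengthD)
  have rel: "(bs ! i, as ! i) \<in> \<alpha>" if "i < ?n" for i
    using ba that lb by (simp add: list_all2_conv_all_nth)
  have ca: "as ! i \<in> carrier A" "bs ! i \<in> carrier A" "cs ! i \<in> carrier A" if "i < ?n" for i
    using rel[OF that] con_carrier cs that by (auto simp: subset_iff)
  have nth: "map (\<lambda>i. xs ! i) [0..<?n] = xs" if "length xs = ?n" for xs :: "'a list"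
    using that by (metis map_nth)
  have cut: "map (\<lambda>i. if i < ?n then g i else k i) [0..<?n] = map g [0..<?n]" for g k :: "nat \<Rightarrow> 'a"
    by (rule map_cong) auto
  have ev_s: "eval_tm A (case_sum (?l xs) (?r ys)) ?s = mo (oper A f xs) (oper A f as) (oper A f ys)"
    if "length xs = ?n" "length ys = ?n" for xs ys
    using that len by (simp add: comp_def cut nth)
  have ev_t: "eval_tm A (case_sum (?l xs) (?r ys)) ?t
    = oper A f (map (\<lambda>i. mo (xs ! i) (as ! i) (ys ! i)) [0..<?n])"
    if "length xs = ?n" "length ys = ?n" for xs ys
    by (simp add: comp_def) (intro arg_cong[where f = "oper A f"] map_cong; simp)
  have opc: "oper A f xs \<in> carrier A" if "length xs = ?n" "\<And>i. i < ?n \<Longrightarrow> xs ! i \<in> carrier A" for xs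
    using that alg by (force simp: is_algebra_def in_set_conv_nth)
  have left: "oper A f (map (\<lambda>i. mo (as ! i) (as ! i) (xs ! i)) [0..<?n]) = oper A f xs"
    if "length xs = ?n" "\<And>i. i < ?n \<Longrightarrow> xs ! i \<in> carrier A" for xs
  proof -
    have "map (\<lambda>i. mo (as ! i) (as ! i) (xs ! i)) [0..<?n] = xs"
      using that ca m_left by (intro nth_equalityI) auto
    then show ?thesis by simp
  qed
  have right: "oper A f (map (\<lambda>i. mo (bs ! i) (as ! i) (as ! i)) [0..<?n]) = oper A f bs"
  proof -
    have "map (\<lambda>i. mo (bs ! i) (as ! i) (as ! i)) [0..<?n] = bs"
      using lb rel m_right by (intro nth_equalityI) auto
    then show ?thesis by simp
  qed
  have "eval_tm A (case_sum (?l bs) (?r cs)) ?s = eval_tm A (case_sum (?l bs) (?r cs)) ?t"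
  proof (rule term_eqI[where a = "?l as" and c = "?r as"])
    show "wf_tm ar ?s" "wf_tm ar ?t" by (auto intro!: wf_Mt wf_tm.intros simp: ar_m)
    show "(?l as i, ?l bs i) \<in> \<alpha>" for i using rel con_sym con_refl u by auto
    show "?r as j \<in> carrier A" "?r cs j \<in> carrier A" for j using ca u by auto
    show "eval_tm A (case_sum (?l as) (?r as)) ?s = eval_tm A (case_sum (?l as) (?r as)) ?t"
      unfolding ev_s[OF len len] ev_t[OF len len]
      using left[OF len] opc[OF len] ca m_left by simp
    show "eval_tm A (case_sum (?l as) (?r cs)) ?s = eval_tm A (case_sum (?l as) (?r cs)) ?t"
      unfolding ev_s[OF len cs(1)] ev_t[OF len cs(1)]
      using left[OF cs(1)] opc[OF len] opc[OF cs(1)] ca m_left by simp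
    show "eval_tm A (case_sum (?l bs) (?r as)) ?s = eval_tm A (case_sum (?l bs) (?r as)) ?t"
      unfolding ev_s[OF lb len] ev_t[OF lb len] right
      using con_oper[OF lb ba] m_right by simp
  qed
  then show ?thesis unfolding ev_s[OF lb cs(1)] ev_t[OF lb cs(1)] .
qed

section \<open>The explicit form of the congruence \<open>Delta\<close>\<close>

definition trl :: "(('a \<times> 'a) \<times> ('a \<times> 'a)) set" where
  "trl = {((a, b), (c, d)). (a, b) \<in> \<alpha> \<and> (c, d) \<in> \<alpha> \<and> d = mo b a c}"

lemma trl_iff: "((a, b), (c, d)) \<in> trl \<longleftrightarrow> (a, b) \<in> \<alpha> \<and> (c, d) \<in> \<alpha> \<and> d = mo b a c"
  by (simp add: trl_def)

text \<open>Reflexivity is \<open>m_right\<close>; symmetry and transitivity come from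
  \<open>mo_trans\<close>, compatibility with the operations from \<open>mo_oper\<close>.\<close>

lemma congruence_trl: "congruence ar (con_alg A \<alpha>) trl"
  unfolding congruence_def
proof (intro conjI allI impI)
  show "equiv (carrier (con_alg A \<alpha>)) trl"
  proof (rule equivI)
    show "trl \<subseteq> carrier (con_alg A \<alpha>) \<times> carrier (con_alg A \<alpha>)"
      by (auto simp: trl_def con_alg_def)
    show "refl_on (carrier (con_alg A \<alpha>)) trl"
      using con_sym m_right by (auto simp: refl_on_def con_alg_def trl_iff)
    show "sym trl"
    proof (rule symI, clarify)
      fix a b c d assume "((a, b), (c, d)) \<in> trl"
      then have *: "(a, b) \<in> \<alpha>" "(c, d) \<in> \<alpha>" "d = mo b a c" by (auto simp: trl_iff)
      then have "mo d c a = mo b a a" using mo_trans[OF con_sym] con_carrier by metis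
      with * show "((c, d), (a, b)) \<in> trl" using con_sym m_right by (auto simp: trl_iff)
    qed
    show "trans trl"
    proof (rule transI, clarify)
      fix a b c d e g assume "((a, b), (c, d)) \<in> trl" "((c, d), (e, g)) \<in> trl"
      then have *: "(a, b) \<in> \<alpha>" "(c, d) \<in> \<alpha>" "d = mo b a c" "(e, g) \<in> \<alpha>" "g = mo d c e"
        by (auto simp: trl_iff)
      then have "mo d c e = mo b a e" using mo_trans[OF con_sym] con_carrier by metis
      with * show "((a, b), (e, g)) \<in> trl" by (auto simp: trl_iff)
    qed
  qed
next
  fix f ps qs
  assume *: "length ps = ar f \<and> list_all2 (\<lambda>x y. (x, y) \<in> trl) ps qs"
  then have len: "length ps = ar f" "length qs = ar f" by (auto dest: list_all2_lengthD)
  have i: "(fst (ps ! i), snd (ps ! i)) \<in> \<alpha>" "(fst (qs ! i), snd (qs ! i)) \<in> \<alpha>"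
    "snd (qs ! i) = mo (snd (ps ! i)) (fst (ps ! i)) (fst (qs ! i))" if "i < ar f" for i
    using list_all2_nthD[of "\<lambda>x y. (x, y) \<in> trl" ps qs i] * that len
    by (auto simp: trl_def split: prod.splits)
  have "mo (oper A f (map snd ps)) (oper A f (map fst ps)) (oper A f (map fst qs))
    = oper A f (map (\<lambda>i. mo (map snd ps ! i) (map fst ps ! i) (map fst qs ! i)) [0..<ar f])"
  proof (rule mo_oper)
    show "list_all2 (\<lambda>x y. (x, y) \<in> \<alpha>) (map snd ps) (map fst ps)"
      using i len con_sym by (simp add: list_all2_conv_all_nth)
    show "set (map fst qs) \<subseteq> carrier A"
      using i(2) len con_carrier by (force simp: in_set_conv_nth)
  qed (use len in auto)
  also have "map (\<lambda>i. mo (map snd ps ! i) (map fst ps ! i) (map fst qs ! i)) [0..<ar f] = map snd qs"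
    using len i(3) by (intro nth_equalityI) auto
  finally have eq: "oper A f (map snd qs)
    = mo (oper A f (map snd ps)) (oper A f (map fst ps)) (oper A f (map fst qs))" by simp
  have "(oper A f (map fst ps), oper A f (map snd ps)) \<in> \<alpha>"
    "(oper A f (map fst qs), oper A f (map snd qs)) \<in> \<alpha>"
    using i len by (auto intro!: con_oper simp: list_all2_conv_all_nth)
  with eq show "(oper (con_alg A \<alpha>) f ps, oper (con_alg A \<alpha>) f qs) \<in> trl"
    by (simp add: con_alg_def trl_iff)
qed

text \<open>The generating pairs lie in \<open>trl\<close> since m(u,u,v) = v. Conversely, a
  congruence containing them relates m((a,b),(a,a),(a,a)) = (a,b) to m((a,b),(a,a),(c,c)) = (c,
  m(b,a,c)).\<close>

lemma Delta_eq_trl: "Delta ar A \<alpha> = trl"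
proof
  have "{((u, u), (v, v)) |u v. u \<in> carrier A \<and> v \<in> carrier A} \<subseteq> trl"
    using con_refl m_left by (auto simp: trl_iff)
  then show "Delta ar A \<alpha> \<subseteq> trl"
    using congruence_trl unfolding Delta_def Cg_def by blast
  show "trl \<subseteq> Delta ar A \<alpha>"
    unfolding Delta_def Cg_def
  proof (clarify)
    fix a b c d \<theta>
    assume "((a, b), (c, d)) \<in> trl" and \<theta>: "congruence ar (con_alg A \<alpha>) \<theta>"
      and sub: "{((u, u), (v, v)) |u v. u \<in> carrier A \<and> v \<in> carrier A} \<subseteq> \<theta>"
    then have *: "(a, b) \<in> \<alpha>" "(c, d) \<in> \<alpha>" "d = mo b a c" by (auto simp: trl_iff)
    then have "((a, b), (a, b)) \<in> \<theta>"
      using congruence_refl[OF \<theta>, of "(a, b)"] by (simp add: con_alg_def)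
    moreover have "((a, a), (a, a)) \<in> \<theta>" "((a, a), (c, c)) \<in> \<theta>"
      using sub con_carrier * by auto
    ultimately have "list_all2 (\<lambda>p q. (p, q) \<in> \<theta>) [(a, b), (a, a), (a, a)] [(a, b), (a, a), (c, c)]"
      by simp
    then have "(oper (con_alg A \<alpha>) m [(a, b), (a, a), (a, a)],
        oper (con_alg A \<alpha>) m [(a, b), (a, a), (c, c)]) \<in> \<theta>"
      using \<theta> ar_m unfolding congruence_def by auto
    then show "((a, b), (c, d)) \<in> \<theta>"
      using * m_left m_right con_carrier con_sym by (simp add: con_alg_def)
  qed
qed

lemma congruence_Delta: "congruence ar (con_alg A \<alpha>) (Delta ar A \<alpha>)"
  by (simp add: Delta_eq_trl congruence_trl)

text \<open>An endomorphism \<open>h\<close> preserving the \<open>\<alpha>\<close>-classes gives a homomorphism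
  \<open>x \<mapsto> (x, h x)\<close> from \<open>A\<close> to the abelian algebra \<open>A(\<alpha>)/\<Delta>\<close>, whose kernel therefore contains
  \<open>[1,1]\<close>. Abelianness is used in the form that \<open>(x, h x)\<close> is \<open>\<Delta>\<close>-related to
  exactly one pair with any prescribed first entry \<open>u\<close>, on which the term
  condition of \<open>A\<close> applies.\<close>

lemma commutator_top_trl:
  assumes h: "is_hom ar A A h" and h\<alpha>: "\<And>x. x \<in> carrier A \<Longrightarrow> (x, h x) \<in> \<alpha>"
    and xy: "(x, y) \<in> commutator ar A (top_con A) (top_con A)"
  shows "((x, h x), (y, h y)) \<in> trl"
proof -
  let ?C = "con_alg A \<alpha>"
  let ?g = "\<lambda>x. (x, h x)"
  let ?\<Phi> = "pullback A ?g trl"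
  note t_sym = congruence_sym[OF congruence_trl] and t_trans = congruence_trans[OF congruence_trl]
  have g: "is_hom ar A ?C ?g"
    using h h\<alpha> by (auto simp: is_hom_def con_alg_def comp_def)
  obtain u where u: "u \<in> carrier A" using alg by (auto simp: is_algebra_def)
  \<comment> \<open>\<open>(u, z x)\<close> is the representative of the class of
    \<open>(x, h x)\<close> in the fixed column \<open>u\<close>.\<close>
  define z where "z x = mo (h x) x u" for x
  have zR: "(?g x, (u, z x)) \<in> trl" if "x \<in> carrier A" for x
    using that h\<alpha>[OF that] con_mo_shift[OF con_sym u] con_sym by (auto simp: trl_iff z_def)
  have z\<alpha>: "(z x, z y) \<in> \<alpha>" if "x \<in> carrier A" "y \<in> carrier A" for x y
    using zR that con_sym con_trans by (meson trl_iff)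
  have zc: "z x \<in> carrier A" if "x \<in> carrier A" for x
    using z\<alpha>[OF that that] con_carrier by blast
  \<comment> \<open>Evaluate \<open>t\<close> in \<open>A(\<alpha>)\<close> at the pairs
    \<open>?g (\<rho> v)\<close> and at their representatives \<open>(u, z (\<rho> v))\<close>. The
    results are related, and the first is \<open>?g\<close> of the value of \<open>t\<close> because
    \<open>?g\<close> is a homomorphism.\<close>
  have ev: "(?g (eval_tm A \<rho> t), (eval_tm A (\<lambda>_. u) t, eval_tm A (\<lambda>v. z (\<rho> v)) t)) \<in> trl"
    if t: "wf_tm ar t" and \<rho>: "\<And>v. \<rho> v \<in> carrier A" for t :: "('f, nat + nat) tm" and \<rho>
  proof -
    have "(eval_tm ?C (\<lambda>v. ?g (\<rho> v)) t, eval_tm ?C (\<lambda>v. (u, z (\<rho> v))) t) \<in> trl"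
      using zR[OF \<rho>] by (intro eval_tm_congruence[OF congruence_trl t])
    then show ?thesis
      using eval_tm_hom[where \<rho> = \<rho>, OF alg g t \<rho>] by (simp add: eval_tm_con_alg)
  qed
  have inj: "p = q" if "((v, p), (v, q)) \<in> trl" for v p q
    using that con_sym m_right by (auto simp: trl_iff)
  have "centralizes ar A (top_con A) (top_con A) ?\<Phi>"
    unfolding centralizes_def
  proof (intro allI impI)
    fix t :: "('f, nat + nat) tm" and a b c d
    assume H: "wf_tm ar t \<and> (\<forall>i. (a i, b i) \<in> top_con A) \<and> (\<forall>j. (c j, d j) \<in> top_con A) \<and>
      (eval_tm A (case_sum a c) t, eval_tm A (case_sum a d) t) \<in> ?\<Phi>"
    then have t: "wf_tm ar t" and abcd: "a i \<in> carrier A" "b i \<in> carrier A"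
      "c i \<in> carrier A" "d i \<in> carrier A" for i
      by (auto simp: top_con_def)
    \<comment> \<open>All four values have this first entry, whichever of the arguments a, b, c, d
      are used, so \<open>inj\<close> can compare their second entries.\<close>
    let ?v = "eval_tm A (\<lambda>_. u) t"
    let ?z = "\<lambda>p i. z (p i)"
    have E: "(?g (eval_tm A (case_sum p q) t), (?v, eval_tm A (case_sum (?z p) (?z q)) t)) \<in> trl"
      if "\<And>i. p i \<in> carrier A" "\<And>i. q i \<in> carrier A" for p q
    proof -
      have "(\<lambda>v. z (case_sum p q v)) = case_sum (?z p) (?z q)"
        by (auto simp: fun_eq_iff split: sum.split)
      with ev[OF t, of "case_sum p q"] that show ?thesis by (auto split: sum.splits)
    qed
    note Eac = E[of a c, OF abcd(1,3)] and Ead = E[of a d, OF abcd(1,4)]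
      and Ebc = E[of b c, OF abcd(2,3)] and Ebd = E[of b d, OF abcd(2,4)]
    have "(?g (eval_tm A (case_sum a c) t), ?g (eval_tm A (case_sum a d) t)) \<in> trl"
      using H by (simp add: pullback_def)
    then have "((?v, eval_tm A (case_sum (?z a) (?z c)) t),
        (?v, eval_tm A (case_sum (?z a) (?z d)) t)) \<in> trl"
      by (rule t_trans[OF t_sym[OF Eac] t_trans[OF _ Ead]])
    then have "eval_tm A (case_sum (?z a) (?z c)) t = eval_tm A (case_sum (?z a) (?z d)) t"
      by (rule inj)
    \<comment> \<open>All values of \<open>z\<close> lie in the \<open>\<alpha>\<close>-class of
      \<open>u\<close>. Replacing the first block is thus a move inside \<open>\<alpha>\<close>,
      although a and b are arbitrary.\<close>
    then have eq: "eval_tm A (case_sum (?z b) (?z c)) t = eval_tm A (case_sum (?z b) (?z d)) t"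
      by (rule term_condition[OF t, where a = "?z a", rotated 3]) (rule z\<alpha> zc abcd)+
    have "(?g (eval_tm A (case_sum b c) t), ?g (eval_tm A (case_sum b d) t)) \<in> trl"
      by (rule t_trans[OF Ebc[unfolded eq] t_sym[OF Ebd]])
    then show "(eval_tm A (case_sum b c) t, eval_tm A (case_sum b d) t) \<in> ?\<Phi>"
      using abcd t by (auto simp: pullback_def intro!: eval_tm_in_carrier[OF alg] split: sum.split)
  qed
  moreover have "congruence ar A ?\<Phi>"
    using alg g congruence_trl by (rule congruence_pullback)
  ultimately show ?thesis
    using xy by (auto simp: commutator_def pullback_def)
qed

text \<open>Membership in \<open>[1,1]\<close> gives h y = m(h x, x, y). Membership in
  \<open>\<alpha>\<close> puts x, y and h x into one class, so that \<open>mo_commute\<close> can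
  turn this into h y = m(y, x, h x). Both halves of the meet \<open>\<alpha> \<and> [1,1]\<close>
  are used.\<close>

lemma Delta_endomorphism:
  assumes h: "is_hom ar A A h" and h\<alpha>: "\<And>x. x \<in> carrier A \<Longrightarrow> (x, h x) \<in> \<alpha>"
    and xy: "(x, y) \<in> \<alpha>" "(x, y) \<in> commutator ar A (top_con A) (top_con A)"
  shows "((x, y), (h x, h y)) \<in> Delta ar A \<alpha>"
proof -
  have "(x, h x) \<in> \<alpha>" "(y, h y) \<in> \<alpha>" using h\<alpha> con_carrier xy(1) by blast+
  moreover have "h y = mo (h x) x y"
    using commutator_top_trl[OF h h\<alpha> xy(2)] by (simp add: trl_iff)
  then have "h y = mo y x (h x)"
    using mo_commute[of y x "h x"] xy(1) calculation con_sym by metis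
  ultimately show ?thesis
    unfolding Delta_eq_trl trl_iff using xy(1) con_sym con_trans by blast
qed

end

section \<open>Free algebras and the difference term over arbitrary carrier types\<close>

text \<open>The subalgebra of \<open>B\<close> generated by the values of \<open>\<rho>\<close>, transported along
  \<open>b \<mapsto> {t. t evaluates to b}\<close> to the types over which \<open>freely_generated\<close> and
  \<open>difference_term\<close> quantify.\<close>

lemma term_class_subalgebra:
  fixes B :: "('f, 'b) algebra" and \<rho> :: "'v \<Rightarrow> 'b"
  assumes B: "is_algebra ar B" and \<rho>: "\<And>v. \<rho> v \<in> carrier B"
  obtains C :: "('f, ('f, 'v) tm set) algebra" and e
  where "is_algebra ar C" and "is_hom ar C B e" and "inj_on e (carrier C)"
    and "\<And>v. \<rho> v \<in> e ` carrier C"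
proof -
  let ?S = "{eval_tm B \<rho> t | t. wf_tm ar t}"
  define cl where "cl b = {t. wf_tm ar t \<and> eval_tm B \<rho> t = b}" for b
  \<comment> \<open>All terms in \<open>cl b\<close> evaluate to \<open>b\<close>, so the choice
    does not affect the value.\<close>
  define e where "e X = eval_tm B \<rho> (SOME t. t \<in> X)" for X :: "('f, 'v) tm set"
  define C where "C = \<lparr>carrier = cl ` ?S, oper = \<lambda>f Xs. cl (oper B f (map e Xs))\<rparr>"
  have e_cl: "e (cl b) = b" if "b \<in> ?S" for b
  proof -
    from that obtain t where "t \<in> cl b" by (auto simp: cl_def)
    then have "(SOME t. t \<in> cl b) \<in> cl b" by (rule someI)
    then show ?thesis by (simp add: e_def cl_def)
  qed
  have eS: "e X \<in> ?S" if "X \<in> carrier C" for X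
    using that e_cl by (auto simp: C_def)
  have S_oper: "oper B f bs \<in> ?S" if "length bs = ar f" "set bs \<subseteq> ?S" for f bs
  proof -
    have "\<forall>b\<in>set bs. \<exists>t. wf_tm ar t \<and> eval_tm B \<rho> t = b" using that(2) by auto
    then obtain tt where tt: "\<And>b. b \<in> set bs \<Longrightarrow> wf_tm ar (tt b) \<and> eval_tm B \<rho> (tt b) = b"
      by metis
    have "wf_tm ar (App f (map tt bs))" using tt that(1) by (auto intro!: wf_tm.intros)
    moreover have "map (eval_tm B \<rho>) (map tt bs) = bs" using tt by (simp add: map_idI)
    then have "eval_tm B \<rho> (App f (map tt bs)) = oper B f bs" by simp
    ultimately show ?thesis by (metis (mono_tags, lifting) mem_Collect_eq)
  qed
  have mapS: "oper B f (map e Xs) \<in> ?S" if "length Xs = ar f" "set Xs \<subseteq> carrier C" for f Xs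
    by (rule S_oper) (use that eS in auto)
  have S_carrier: "?S \<subseteq> carrier B" using eval_tm_in_carrier[OF B _ \<rho>] by auto
  have Var: "\<rho> v \<in> ?S" for v
    using wf_tm.intros(1)[of ar v] eval_tm.simps(1)[of B \<rho> v] by (metis (mono_tags, lifting) mem_Collect_eq)
  show thesis
  proof
    show "is_algebra ar C"
      unfolding is_algebra_def
    proof (intro conjI allI impI)
      show "carrier C \<noteq> {}" using imageI[OF Var, of cl] unfolding C_def algebra.simps by blast
      show "oper C f Xs \<in> carrier C" if "length Xs = ar f \<and> set Xs \<subseteq> carrier C" for f Xs
        using imageI[OF mapS[of Xs f], of cl] that unfolding C_def algebra.simps by blast
    qed
    show "is_hom ar C B e"
      unfolding is_hom_def
    proof (intro conjI ballI allI impI)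
      show "e X \<in> carrier B" if "X \<in> carrier C" for X using eS[OF that] S_carrier by blast
      show "e (oper C f Xs) = oper B f (map e Xs)"
        if "length Xs = ar f \<and> set Xs \<subseteq> carrier C" for f Xs
        using e_cl[OF mapS] that by (simp add: C_def)
    qed
    show "inj_on e (carrier C)"
    proof (rule inj_on_inverseI[where g = cl])
      fix X assume "X \<in> carrier C"
      then obtain b where "X = cl b" "b \<in> ?S" unfolding C_def algebra.simps by (rule imageE)
      then show "cl (e X) = X" using e_cl by simp
    qed
    show "\<rho> v \<in> e ` carrier C" for v
      using e_cl[OF Var, of v] imageI[OF imageI[OF Var, of cl v], of e]
      unfolding C_def algebra.simps by simp
  qed
qed

text \<open>Only the subalgebra generated by \<open>x\<close> and \<open>y\<close> matters, and it
  has a copy over the type tested by \<open>difference_term\<close>. The commutator computed in the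
  copy maps into that of \<open>B\<close> by \<open>commutator_hom\<close>, which allows
  \<open>e\<close> to be a proper embedding.\<close>

lemma difference_term_in_variety:
  fixes B :: "('f, 'b) algebra"
  assumes E: "wf_identities ar E" and m: "difference_term ar E m" and B: "in_variety ar E B"
    and x: "x \<in> carrier B" and y: "y \<in> carrier B"
  shows "oper B m [x, x, y] = y"
    and "congruence ar B \<alpha> \<Longrightarrow> (x, y) \<in> \<alpha> \<Longrightarrow> (x, oper B m [x, y, y]) \<in> commutator ar B \<alpha> \<alpha>"
proof -
  have alg: "is_algebra ar B" using B by (simp add: in_variety_def)
  have ar: "ar m = 3" using m by (simp add: difference_term_def)
  define \<rho> where "\<rho> n = (if n = (0::nat) then x else y)" for n
  have "\<rho> n \<in> carrier B" for n using x y by (simp add: \<rho>_def)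
  then obtain C :: "('f, ('f, nat) tm set) algebra" and e
    where C: "is_algebra ar C" and e: "is_hom ar C B e" and inj: "inj_on e (carrier C)"
      and im: "\<And>n. \<rho> n \<in> e ` carrier C"
    using term_class_subalgebra[OF alg, of \<rho>] by metis
  obtain x' y' where xy: "x' \<in> carrier C" "y' \<in> carrier C" "e x' = x" "e y' = y"
    using im[of 0] im[of 1] by (auto simp: \<rho>_def)
  have CV: "in_variety ar E C" using B E C e inj by (rule in_variety_embedded)
  have op: "e (oper C m [u, v, w]) = oper B m [e u, e v, e w]"
    if "u \<in> carrier C" "v \<in> carrier C" "w \<in> carrier C" for u v w
    using e that ar by (simp add: is_hom_def)
  have "oper C m [x', x', y'] = y'"
    using m CV xy unfolding difference_term_def by blast
  then show "oper B m [x, x, y] = y" using op xy by metis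
  assume \<alpha>: "congruence ar B \<alpha>" "(x, y) \<in> \<alpha>"
  have "(x', oper C m [x', y', y']) \<in> commutator ar C (pullback C e \<alpha>) (pullback C e \<alpha>)"
  proof -
    have "congruence ar C (pullback C e \<alpha>)" using C e \<alpha>(1) by (rule congruence_pullback)
    moreover have "(x', y') \<in> pullback C e \<alpha>" using xy \<alpha>(2) by (simp add: pullback_def)
    ultimately show ?thesis using m CV unfolding difference_term_def by blast
  qed
  also have "\<dots> \<subseteq> pullback C e (commutator ar B \<alpha> \<alpha>)"
    using C e by (rule commutator_hom) auto
  finally show "(x, oper B m [x, y, y]) \<in> commutator ar B \<alpha> \<alpha>"
    using op xy by (simp add: pullback_def)
qed

lemma freely_generated_extend:
  fixes F :: "('f, 'a) algebra" and B :: "('f, 'b) algebra"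
  assumes E: "wf_identities ar E" and F: "freely_generated ar E F X" and B: "in_variety ar E B"
    and g: "\<And>x. x \<in> X \<Longrightarrow> g x \<in> carrier B"
  obtains h where "is_hom ar F B h" and "\<And>x. x \<in> X \<Longrightarrow> h x = g x"
proof -
  have alg: "is_algebra ar B" using B by (simp add: in_variety_def)
  then obtain b where b: "b \<in> carrier B" by (auto simp: is_algebra_def)
  \<comment> \<open>Variables range over the whole type, so those outside \<open>X\<close> need some
    value in the carrier.\<close>
  define \<rho> where "\<rho> x = (if x \<in> X then g x else b)" for x
  have "\<rho> x \<in> carrier B" for x using g b by (simp add: \<rho>_def)
  then obtain C :: "('f, ('f, 'a) tm set) algebra" and e
    where C: "is_algebra ar C" and e: "is_hom ar C B e" and inj: "inj_on e (carrier C)"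
      and im: "\<And>n. \<rho> n \<in> e ` carrier C"
    using term_class_subalgebra[OF alg, of \<rho>] by metis
  have CV: "in_variety ar E C" using B E C e inj by (rule in_variety_embedded)
  have "\<forall>x. \<exists>c. c \<in> carrier C \<and> e c = \<rho> x" using im by (metis imageE)
  then obtain c where c: "\<And>x. c x \<in> carrier C" "\<And>x. e (c x) = \<rho> x" by metis
  then obtain h where h: "is_hom ar F C h" "\<forall>x\<in>X. h x = c x"
    using F CV unfolding freely_generated_def by meson
  show thesis
  proof (rule that)
    show "is_hom ar F B (\<lambda>x. e (h x))" using h(1) e by (rule is_hom_comp)
    show "e (h x) = g x" if "x \<in> X" for x using that h(2) c(2) by (simp add: \<rho>_def)
  qed
qed

text \<open>Projectivity of free algebras: choose preimages under \<open>q\<close> of the images of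
  the generators and extend. The set where \<open>q (h x) = p x\<close> is a subuniverse containing
  the generators, hence everything.\<close>

lemma free_algebra_lift:
  assumes E: "wf_identities ar E" and F: "free_algebra ar E F" and G: "in_variety ar E G"
    and p: "is_hom ar F Q p" and q: "is_hom ar G Q q" and onto: "carrier Q \<subseteq> q ` carrier G"
  obtains h where "is_hom ar F G h" and "\<And>x. x \<in> carrier F \<Longrightarrow> q (h x) = p x"
proof -
  obtain X where X: "freely_generated ar E F X" using F by (auto simp: free_algebra_def)
  then have Xsub: "X \<subseteq> carrier F" and gen: "generated ar F X = carrier F"
    and algF: "is_algebra ar F"
    by (auto simp: freely_generated_def in_variety_def)
  have "\<forall>x\<in>X. \<exists>y. y \<in> carrier G \<and> q y = p x"
    using Xsub p onto unfolding is_hom_def by (metis imageE subset_iff)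
  then obtain g where g: "\<And>x. x \<in> X \<Longrightarrow> g x \<in> carrier G \<and> q (g x) = p x" by metis
  then obtain h where h: "is_hom ar F G h" "\<And>x. x \<in> X \<Longrightarrow> h x = g x"
    using freely_generated_extend[OF E X G, of g] by metis
  let ?S = "{x \<in> carrier F. q (h x) = p x}"
  have "subuniverse ar F ?S"
    unfolding subuniverse_def
  proof (intro conjI allI impI)
    fix f xs assume *: "length xs = ar f \<and> set xs \<subseteq> ?S"
    then have xs: "set xs \<subseteq> carrier F" by auto
    have "q (h (oper F f xs)) = oper Q f (map (\<lambda>x. q (h x)) xs)"
      using is_hom_comp[OF h(1) q] * xs by (simp add: is_hom_def)
    also have "map (\<lambda>x. q (h x)) xs = map p xs" using * by auto
    also have "oper Q f (map p xs) = p (oper F f xs)" using p * xs by (simp add: is_hom_def)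
    finally show "oper F f xs \<in> ?S" using algF * xs by (simp add: is_algebra_def)
  qed auto
  moreover have "X \<subseteq> ?S" using Xsub g h(2) by auto
  ultimately have "generated ar F X \<subseteq> ?S" unfolding generated_def by blast
  with gen h(1) that show thesis by blast
qed

text \<open>Trades the isomorphism for an onto map with kernel \<open>\<theta>\<close>, the form
  that liftings require.\<close>

lemma free_presentation_map:
  assumes "free_presentation ar E F \<theta> Q"
  obtains p where "is_hom ar F Q p" and "carrier Q \<subseteq> p ` carrier F"
    and "\<theta> = pullback F p Id"
proof -
  have \<theta>: "congruence ar F \<theta>" using assms by (simp add: free_presentation_def)
  obtain i where i: "is_hom ar (quot_alg F \<theta>) Q i"
    "bij_betw i (carrier (quot_alg F \<theta>)) (carrier Q)"
    using assms by (auto simp: free_presentation_def isomorphic_def)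
  have c: "carrier (quot_alg F \<theta>) = (\<lambda>x. \<theta> `` {x}) ` carrier F"
    by (auto simp: quot_alg_def quotient_def)
  show thesis
  proof
    show "is_hom ar F Q (\<lambda>x. i (\<theta> `` {x}))"
      using is_hom_quot_proj[OF \<theta>] i(1) by (rule is_hom_comp)
    show "carrier Q \<subseteq> (\<lambda>x. i (\<theta> `` {x})) ` carrier F"
      using bij_betw_imp_surj_on[OF i(2)] unfolding c image_image by (rule equalityD2)
    have "i (\<theta> `` {x}) = i (\<theta> `` {y}) \<longleftrightarrow> (x, y) \<in> \<theta>" if "x \<in> carrier F" "y \<in> carrier F" for x y
      using inj_on_eq_iff[OF bij_betw_imp_inj_on[OF i(2)], of "\<theta> `` {x}" "\<theta> `` {y}"]
        congruence_class_eq[OF \<theta> that] that unfolding c by blast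
    then show "\<theta> = pullback F (\<lambda>x. i (\<theta> `` {x})) Id"
      using congruence_subset[OF \<theta>] by (auto simp: pullback_def)
  qed
qed

section \<open>The quotient by the commutator with 1\<close>

text \<open>\<open>\<alpha>\<close> satisfies its own term condition: t(b,c) \<open>\<alpha>\<close>
  t(a,c) \<open>\<alpha>\<close> t(a,d) \<open>\<alpha>\<close> t(b,d).\<close>

lemma commutator_subset_left:
  fixes A :: "('f, 'a) algebra"
  assumes A: "is_algebra ar A" and \<alpha>: "congruence ar A \<alpha>"
  shows "commutator ar A \<alpha> (top_con A) \<subseteq> \<alpha>"
proof -
  have "centralizes ar A \<alpha> (top_con A) \<alpha>"
    unfolding centralizes_def
  proof (intro allI impI)
    fix t :: "('f, nat + nat) tm" and a b c d
    assume H: "wf_tm ar t \<and> (\<forall>i. (a i, b i) \<in> \<alpha>) \<and> (\<forall>j. (c j, d j) \<in> top_con A) \<and>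
      (eval_tm A (case_sum a c) t, eval_tm A (case_sum a d) t) \<in> \<alpha>"
    have *: "(eval_tm A (case_sum a e) t, eval_tm A (case_sum b e) t) \<in> \<alpha>"
      if "\<And>j. e j \<in> carrier A" for e
    proof (rule eval_tm_congruence[OF \<alpha>])
      show "wf_tm ar t" using H by blast
      show "(case_sum a e v, case_sum b e v) \<in> \<alpha>" for v
        using H that congruence_refl[OF \<alpha>] by (cases v) auto
    qed
    have cd: "\<And>j. c j \<in> carrier A" "\<And>j. d j \<in> carrier A" using H by (auto simp: top_con_def)
    have "(eval_tm A (case_sum a c) t, eval_tm A (case_sum a d) t) \<in> \<alpha>" using H by blast
    then show "(eval_tm A (case_sum b c) t, eval_tm A (case_sum b d) t) \<in> \<alpha>"
      by (rule congruence_trans[OF \<alpha> congruence_sym[OF \<alpha> *[of c, OF cd(1)]]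
          congruence_trans[OF \<alpha> _ *[of d, OF cd(2)]]])
  qed
  with \<alpha> show ?thesis by (auto simp: commutator_def)
qed

text \<open>Since \<open>\<delta> \<subseteq> \<alpha>\<close>, changing representatives modulo
  \<open>\<delta>\<close> does not leave the \<open>\<alpha>\<close>-class.\<close>

lemma quot_con_iff:
  assumes \<alpha>: "congruence ar A \<alpha>" and \<delta>: "congruence ar A \<delta>" and sub: "\<delta> \<subseteq> \<alpha>"
    and xy: "x \<in> carrier A" "y \<in> carrier A"
  shows "(\<delta> `` {x}, \<delta> `` {y}) \<in> quot_con \<alpha> \<delta> \<longleftrightarrow> (x, y) \<in> \<alpha>"
proof
  assume "(\<delta> `` {x}, \<delta> `` {y}) \<in> quot_con \<alpha> \<delta>"
  then obtain x' y' where *: "(x', y') \<in> \<alpha>" "\<delta> `` {x} = \<delta> `` {x'}" "\<delta> `` {y} = \<delta> `` {y'}"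
    by (auto simp: quot_con_def)
  moreover from *(1) have "x' \<in> carrier A" "y' \<in> carrier A"
    using congruence_subset[OF \<alpha>] by auto
  ultimately have "(x, x') \<in> \<alpha>" "(y, y') \<in> \<alpha>"
    using congruence_class_eq[OF \<delta>] xy sub by blast+
  then show "(x, y) \<in> \<alpha>"
    using *(1) congruence_sym[OF \<alpha>] congruence_trans[OF \<alpha>] by metis
qed (auto simp: quot_con_def)

lemma congruence_quot_con:
  assumes A: "is_algebra ar A" and \<alpha>: "congruence ar A \<alpha>" and \<delta>: "congruence ar A \<delta>"
    and sub: "\<delta> \<subseteq> \<alpha>"
  shows "congruence ar (quot_alg A \<delta>) (quot_con \<alpha> \<delta>)"
proof -
  note iff = quot_con_iff[OF \<alpha> \<delta> sub]
  have c: "carrier (quot_alg A \<delta>) = (\<lambda>x. \<delta> `` {x}) ` carrier A"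
    by (auto simp: quot_alg_def quotient_def)
  have sb: "quot_con \<alpha> \<delta> \<subseteq> carrier (quot_alg A \<delta>) \<times> carrier (quot_alg A \<delta>)"
    using congruence_subset[OF \<alpha>] unfolding c by (auto simp: quot_con_def)
  show ?thesis
    unfolding congruence_def
  proof (intro conjI allI impI)
    show "equiv (carrier (quot_alg A \<delta>)) (quot_con \<alpha> \<delta>)"
    proof (rule equivI)
      show "refl_on (carrier (quot_alg A \<delta>)) (quot_con \<alpha> \<delta>)"
        unfolding refl_on_def c using iff congruence_refl[OF \<alpha>] by auto
      show "sym (quot_con \<alpha> \<delta>)"
        using congruence_sym[OF \<alpha>] by (force simp: sym_def quot_con_def)
      show "trans (quot_con \<alpha> \<delta>)"
      proof (rule transI)
        fix X Y Z assume *: "(X, Y) \<in> quot_con \<alpha> \<delta>" "(Y, Z) \<in> quot_con \<alpha> \<delta>"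
        then have "X \<in> carrier (quot_alg A \<delta>)" "Y \<in> carrier (quot_alg A \<delta>)"
          "Z \<in> carrier (quot_alg A \<delta>)" using sb by auto
        then obtain x y z where xyz: "x \<in> carrier A" "y \<in> carrier A" "z \<in> carrier A"
          and XYZ: "X = \<delta> `` {x}" "Y = \<delta> `` {y}" "Z = \<delta> `` {z}"
          unfolding c by blast
        have "(x, y) \<in> \<alpha>" "(y, z) \<in> \<alpha>" using * iff xyz unfolding XYZ by auto
        then have "(x, z) \<in> \<alpha>" by (rule congruence_trans[OF \<alpha>])
        then show "(X, Z) \<in> quot_con \<alpha> \<delta>" using iff xyz unfolding XYZ by auto
      qed
    qed (fact sb)
  next
    fix f Xs Ys
    assume *: "length Xs = ar f \<and> list_all2 (\<lambda>x y. (x, y) \<in> quot_con \<alpha> \<delta>) Xs Ys"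
    then have "set Xs \<subseteq> carrier (quot_alg A \<delta>)" "set Ys \<subseteq> carrier (quot_alg A \<delta>)"
      using list_all2_set_subset[OF _ sb, of Xs Ys] by auto
    then obtain xs ys where xs: "set xs \<subseteq> carrier A" "Xs = map (\<lambda>x. \<delta> `` {x}) xs"
      and ys: "set ys \<subseteq> carrier A" "Ys = map (\<lambda>x. \<delta> `` {x}) ys"
      using carrier_quot_list by metis
    have len: "length xs = ar f" "length ys = ar f"
      using * xs(2) ys(2) by (auto dest: list_all2_lengthD)
    have mem: "xs ! i \<in> carrier A" "ys ! i \<in> carrier A" if "i < ar f" for i
      using that len xs(1) ys(1) by (auto simp: subset_iff)
    have "list_all2 (\<lambda>x y. (x, y) \<in> \<alpha>) xs ys"
      using * iff mem len by (auto simp: xs(2) ys(2) list_all2_conv_all_nth)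
    then have "(oper A f xs, oper A f ys) \<in> \<alpha>" using \<alpha> len by (simp add: congruence_def)
    then show "(oper (quot_alg A \<delta>) f Xs, oper (quot_alg A \<delta>) f Ys) \<in> quot_con \<alpha> \<delta>"
      unfolding xs(2) ys(2) oper_quot_alg[OF \<delta> len(1) xs(1)] oper_quot_alg[OF \<delta> len(2) ys(1)]
      by (auto simp: quot_con_def)
  qed
qed

text \<open>Dividing by \<open>\<delta>\<close> turns
  C(\<open>\<alpha>\<close>,1;\<open>\<delta>\<close>) into centrality: choose representatives of
  all arguments and evaluate terms in \<open>A\<close>, where equality of classes is membership in
  \<open>\<delta>\<close>.\<close>

lemma central_quotient:
  fixes A :: "('f, 'a) algebra"
  assumes A: "is_algebra ar A" and \<alpha>: "congruence ar A \<alpha>"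
    and \<delta>_def: "\<delta> = commutator ar A \<alpha> (top_con A)"
  shows "centralizes ar (quot_alg A \<delta>) (quot_con \<alpha> \<delta>) (top_con (quot_alg A \<delta>)) Id"
  unfolding centralizes_def
proof (intro allI impI)
  have \<alpha>1: "\<alpha> \<subseteq> top_con A" using congruence_subset[OF \<alpha>] by (simp add: top_con_def)
  have \<delta>: "congruence ar A \<delta>" "centralizes ar A \<alpha> (top_con A) \<delta>"
    unfolding \<delta>_def by (intro congruence_commutator centralizes_commutator A \<alpha>1 order_refl)+
  let ?\<pi> = "\<lambda>x. \<delta> `` {x}"
  fix t :: "('f, nat + nat) tm" and a b c d
  assume H: "wf_tm ar t \<and> (\<forall>i. (a i, b i) \<in> quot_con \<alpha> \<delta>) \<and>
    (\<forall>j. (c j, d j) \<in> top_con (quot_alg A \<delta>)) \<and>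
    (eval_tm (quot_alg A \<delta>) (case_sum a c) t, eval_tm (quot_alg A \<delta>) (case_sum a d) t) \<in> Id"
  have "\<exists>x y. (x, y) \<in> \<alpha> \<and> a i = ?\<pi> x \<and> b i = ?\<pi> y" for i
  proof -
    have "(a i, b i) \<in> quot_con \<alpha> \<delta>" using H by blast
    then show ?thesis unfolding quot_con_def by blast
  qed
  then obtain a' b' where ab: "\<And>i. (a' i, b' i) \<in> \<alpha>" "\<And>i. a i = ?\<pi> (a' i)" "\<And>i. b i = ?\<pi> (b' i)"
    by metis
  have "\<exists>x y. x \<in> carrier A \<and> y \<in> carrier A \<and> c i = ?\<pi> x \<and> d i = ?\<pi> y" for i
  proof -
    have "(c i, d i) \<in> top_con (quot_alg A \<delta>)" using H by blast
    then show ?thesis by (auto simp: top_con_def quot_alg_def quotient_def)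
  qed
  then obtain c' d' where cd: "\<And>i. c' i \<in> carrier A" "\<And>i. d' i \<in> carrier A"
    "\<And>i. c i = ?\<pi> (c' i)" "\<And>i. d i = ?\<pi> (d' i)"
    by metis
  have abcd: "a = (\<lambda>i. ?\<pi> (a' i))" "b = (\<lambda>i. ?\<pi> (b' i))" "c = (\<lambda>i. ?\<pi> (c' i))" "d = (\<lambda>i. ?\<pi> (d' i))"
    by (simp_all add: fun_eq_iff ab cd)
  have ab': "a' i \<in> carrier A" "b' i \<in> carrier A" for i
    using ab(1) congruence_subset[OF \<alpha>] by auto
  have t: "wf_tm ar t" using H by simp
  have sum: "case_sum (\<lambda>i. ?\<pi> (p i)) (\<lambda>i. ?\<pi> (q i)) = (\<lambda>v. ?\<pi> (case_sum p q v))" for p q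
    by (auto simp: fun_eq_iff split: sum.split)
  have ev: "eval_tm (quot_alg A \<delta>) (case_sum (\<lambda>i. ?\<pi> (p i)) (\<lambda>i. ?\<pi> (q i))) t
      = ?\<pi> (eval_tm A (case_sum p q) t)" "eval_tm A (case_sum p q) t \<in> carrier A"
    if "\<And>i. p i \<in> carrier A" "\<And>i. q i \<in> carrier A" for p q
  proof -
    have \<rho>: "case_sum p q v \<in> carrier A" for v using that by (cases v) auto
    show "eval_tm A (case_sum p q) t \<in> carrier A" by (rule eval_tm_in_carrier[OF A t \<rho>])
    show "eval_tm (quot_alg A \<delta>) (case_sum (\<lambda>i. ?\<pi> (p i)) (\<lambda>i. ?\<pi> (q i))) t
      = ?\<pi> (eval_tm A (case_sum p q) t)"
      unfolding sum
      using eval_tm_hom[where \<rho> = "case_sum p q", OF A is_hom_quot_proj[OF \<delta>(1)] t \<rho>] by simp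
  qed
  note ac = ev[of a' c', OF ab'(1) cd(1)] and ad = ev[of a' d', OF ab'(1) cd(2)]
    and bc = ev[of b' c', OF ab'(2) cd(1)] and bd = ev[of b' d', OF ab'(2) cd(2)]
  have "?\<pi> (eval_tm A (case_sum a' c') t) = ?\<pi> (eval_tm A (case_sum a' d') t)"
    using H unfolding abcd ac(1) ad(1) by simp
  then have "(eval_tm A (case_sum a' c') t, eval_tm A (case_sum a' d') t) \<in> \<delta>"
    unfolding congruence_class_eq[OF \<delta>(1) ac(2) ad(2)] .
  then have "(eval_tm A (case_sum b' c') t, eval_tm A (case_sum b' d') t) \<in> \<delta>"
    by (rule centralizesD[where a = a' and b = b' and c = c' and d = d', OF \<delta>(2) t ab(1), rotated])
      (simp add: top_con_def cd(1,2))
  then have "?\<pi> (eval_tm A (case_sum b' c') t) = ?\<pi> (eval_tm A (case_sum b' d') t)"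
    unfolding congruence_class_eq[OF \<delta>(1) bc(2) bd(2)] .
  then show "(eval_tm (quot_alg A \<delta>) (case_sum b c) t, eval_tm (quot_alg A \<delta>) (case_sum b d) t) \<in> Id"
    unfolding abcd bc(1) bd(1) by simp
qed

text \<open>The term condition is inherited by a smaller second argument. \<open>Id_on\<close>
  replaces \<open>Id\<close> because a congruence must be a relation on the carrier.\<close>

lemma commutator_central_self:
  fixes A :: "('f, 'a) algebra"
  assumes A: "is_algebra ar A" and \<alpha>: "congruence ar A \<alpha>"
    and cen: "centralizes ar A \<alpha> (top_con A) Id"
  shows "commutator ar A \<alpha> \<alpha> \<subseteq> Id"
proof -
  have "congruence ar A (Id_on (carrier A))"
    unfolding congruence_def
  proof (intro conjI allI impI)
    show "equiv (carrier A) (Id_on (carrier A))"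
      by (rule equivI) (auto simp: refl_on_def sym_def trans_def)
    fix f xs ys
    assume *: "length xs = ar f \<and> list_all2 (\<lambda>x y. (x, y) \<in> Id_on (carrier A)) xs ys"
    then have "set xs \<subseteq> carrier A"
      using list_all2_set_subset(1)[of "Id_on (carrier A)" xs ys "carrier A" "carrier A"] by auto
    moreover have "ys = xs" using * by (auto simp: list_all2_conv_all_nth intro!: nth_equalityI)
    ultimately show "(oper A f xs, oper A f ys) \<in> Id_on (carrier A)"
      using * A by (auto simp: is_algebra_def)
  qed
  moreover have "centralizes ar A \<alpha> \<alpha> (Id_on (carrier A))"
    unfolding centralizes_def
  proof (intro allI impI)
    fix t :: "('f, nat + nat) tm" and a b c d
    assume H: "wf_tm ar t \<and> (\<forall>i. (a i, b i) \<in> \<alpha>) \<and> (\<forall>j. (c j, d j) \<in> \<alpha>) \<and>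
      (eval_tm A (case_sum a c) t, eval_tm A (case_sum a d) t) \<in> Id_on (carrier A)"
    have t: "wf_tm ar t" and ab: "\<And>i. (a i, b i) \<in> \<alpha>" using H by auto
    have mem: "b i \<in> carrier A" "c i \<in> carrier A" "d i \<in> carrier A" for i
      using H congruence_subset[OF \<alpha>] by (meson SigmaD1 SigmaD2 subsetD)+
    have "(eval_tm A (case_sum b c) t, eval_tm A (case_sum b d) t) \<in> Id"
      by (rule centralizesD[OF cen t ab]) (use H mem in \<open>auto simp: top_con_def\<close>)
    moreover have "eval_tm A (case_sum b c) t \<in> carrier A"
      by (rule eval_tm_in_carrier[OF A t]) (use mem in \<open>auto split: sum.split\<close>)
    ultimately show "(eval_tm A (case_sum b c) t, eval_tm A (case_sum b d) t) \<in> Id_on (carrier A)"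
      by auto
  qed
  ultimately show ?thesis by (auto simp: commutator_def)
qed

text \<open>\<open>m_right\<close> is where the difference term pays off: (x, m(x,y,y)) lies in the
  commutator of the central congruence with itself, which is contained in equality.\<close>

lemma central_congruence_quot:
  fixes A :: "('f, 'a) algebra"
  assumes E: "wf_identities ar E" and m: "difference_term ar E m" and A: "in_variety ar E A"
    and \<alpha>: "congruence ar A \<alpha>" and \<delta>_def: "\<delta> = commutator ar A \<alpha> (top_con A)"
  shows "central_congruence ar (quot_alg A \<delta>) m (quot_con \<alpha> \<delta>)"
proof -
  have alg: "is_algebra ar A" using A by (simp add: in_variety_def)
  have \<alpha>1: "\<alpha> \<subseteq> top_con A" using congruence_subset[OF \<alpha>] by (simp add: top_con_def)
  have \<delta>: "congruence ar A \<delta>" "\<delta> \<subseteq> \<alpha>"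
    unfolding \<delta>_def
    by (intro congruence_commutator commutator_subset_left alg \<alpha> \<alpha>1 order_refl)+
  let ?A = "quot_alg A \<delta>" and ?\<alpha> = "quot_con \<alpha> \<delta>"
  have V: "in_variety ar E ?A" using A E \<delta>(1) by (rule in_variety_quot_alg)
  then have alg': "is_algebra ar ?A" by (simp add: in_variety_def)
  have con: "congruence ar ?A ?\<alpha>" using alg \<alpha> \<delta> by (rule congruence_quot_con)
  have cen: "centralizes ar ?A ?\<alpha> (top_con ?A) Id" using alg \<alpha> \<delta>_def by (rule central_quotient)
  show ?thesis
  proof
    show "oper ?A m [x, y, y] = x" if "(x, y) \<in> ?\<alpha>" for x y
    proof -
      have "x \<in> carrier ?A" "y \<in> carrier ?A" using that congruence_subset[OF con] by auto
      then have "(x, oper ?A m [x, y, y]) \<in> commutator ar ?A ?\<alpha> ?\<alpha>"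
        using difference_term_in_variety(2)[OF E m V _ _ con that] by blast
      then show ?thesis using commutator_central_self[OF alg' con cen] by auto
    qed
    show "ar m = 3" using m by (simp add: difference_term_def)
  qed (use alg' con cen difference_term_in_variety(1)[OF E m V] in auto)
qed

section \<open>Functoriality of the Schur multiplier\<close>

lemma is_algebra_con_alg:
  assumes A: "is_algebra ar A" and \<alpha>: "congruence ar A \<alpha>"
  shows "is_algebra ar (con_alg A \<alpha>)"
  unfolding is_algebra_def
proof (intro conjI allI impI)
  show "carrier (con_alg A \<alpha>) \<noteq> {}"
    using A congruence_refl[OF \<alpha>] by (auto simp: is_algebra_def con_alg_def)
  fix f ps assume *: "length ps = ar f \<and> set ps \<subseteq> carrier (con_alg A \<alpha>)"
  then have "list_all2 (\<lambda>x y. (x, y) \<in> \<alpha>) (map fst ps) (map snd ps)"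
    by (auto simp: list_all2_conv_all_nth con_alg_def)
  then show "oper (con_alg A \<alpha>) f ps \<in> carrier (con_alg A \<alpha>)"
    using \<alpha> * by (simp add: congruence_def con_alg_def)
qed

lemma is_hom_con_alg:
  assumes h: "is_hom ar A B h" and \<alpha>: "\<alpha> \<subseteq> pullback A h \<beta>"
  shows "is_hom ar (con_alg A \<alpha>) (con_alg B \<beta>) (map_prod h h)"
  unfolding is_hom_def
proof (intro conjI ballI allI impI)
  show "map_prod h h p \<in> carrier (con_alg B \<beta>)" if "p \<in> carrier (con_alg A \<alpha>)" for p
    using that \<alpha> by (cases p) (auto simp: con_alg_def pullback_def)
  fix f ps assume *: "length ps = ar f \<and> set ps \<subseteq> carrier (con_alg A \<alpha>)"
  then have "set (map fst ps) \<subseteq> carrier A" "set (map snd ps) \<subseteq> carrier A"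
    using \<alpha> by (fastforce simp: con_alg_def pullback_def)+
  then have "h (oper A f (map fst ps)) = oper B f (map h (map fst ps))"
    "h (oper A f (map snd ps)) = oper B f (map h (map snd ps))"
    using h * unfolding is_hom_def by auto
  moreover have "map fst (map (map_prod h h) ps) = map h (map fst ps)"
    "map snd (map (map_prod h h) ps) = map h (map snd ps)"
    by auto
  ultimately show "map_prod h h (oper (con_alg A \<alpha>) f ps)
      = oper (con_alg B \<beta>) f (map (map_prod h h) ps)"
    by (simp add: con_alg_def)
qed

text \<open>The preimage of \<open>Delta\<close> is a congruence, and \<open>h\<close> sends
  diagonal pairs to diagonal pairs, so it contains the generators.\<close>

lemma Delta_hom:
  assumes A: "is_algebra ar A" and \<alpha>: "congruence ar A \<alpha>" and h: "is_hom ar A B h"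
    and sub: "\<alpha> \<subseteq> pullback A h \<beta>" and \<Delta>: "congruence ar (con_alg B \<beta>) (Delta ar B \<beta>)"
  shows "Delta ar A \<alpha> \<subseteq> pullback (con_alg A \<alpha>) (map_prod h h) (Delta ar B \<beta>)"
proof -
  have "congruence ar (con_alg A \<alpha>) (pullback (con_alg A \<alpha>) (map_prod h h) (Delta ar B \<beta>))"
    using is_algebra_con_alg[OF A \<alpha>] is_hom_con_alg[OF h sub] \<Delta> by (rule congruence_pullback)
  moreover have "((h u, h u), (h v, h v)) \<in> Delta ar B \<beta>"
    if "u \<in> carrier A" "v \<in> carrier A" for u v
    using that h by (auto simp: is_hom_def Delta_def Cg_def)
  then have "{((u, u), (v, v)) | u v. u \<in> carrier A \<and> v \<in> carrier A}
      \<subseteq> pullback (con_alg A \<alpha>) (map_prod h h) (Delta ar B \<beta>)"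
    using congruence_refl[OF \<alpha>] by (auto simp: pullback_def con_alg_def)
  ultimately show ?thesis unfolding Delta_def[of ar A] Cg_def by (rule Inter_lower[OF CollectI, OF conjI])
qed

text \<open>The map \<open>k\<close> is fixed by an equation among the assumptions so that both
  conclusions speak of the same function.\<close>

lemma
  fixes h :: "'a \<Rightarrow> 'b" and A :: "('f, 'a) algebra" and B :: "('f, 'b) algebra"
  assumes k_def: "k = (\<lambda>X. Delta ar B \<beta> `` (map_prod h h ` X))"
    and A: "is_algebra ar A" and \<alpha>: "congruence ar A \<alpha>" and h: "is_hom ar A B h"
    and sub: "\<alpha> \<subseteq> pullback A h \<beta>"
    and \<Delta>: "congruence ar (con_alg A \<alpha>) (Delta ar A \<alpha>)"
      "congruence ar (con_alg B \<beta>) (Delta ar B \<beta>)"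
  shows kappa_map: "(x, y) \<in> \<alpha> \<Longrightarrow> k (kappa ar A \<alpha> (x, y)) = kappa ar B \<beta> (h x, h y)"
    and is_hom_kappa_image: "\<gamma> \<subseteq> \<alpha> \<Longrightarrow> \<gamma> \<subseteq> pullback A h \<gamma>' \<Longrightarrow>
      is_hom ar (kappa_image ar A \<alpha> \<gamma>) (kappa_image ar B \<beta> \<gamma>') k"
proof -
  note D = Delta_hom[OF A \<alpha> h sub \<Delta>(2)]
  show map: "k (kappa ar A \<alpha> (x, y)) = kappa ar B \<beta> (h x, h y)" if "(x, y) \<in> \<alpha>" for x y
    using class_image[OF \<Delta> D, of "(x, y)"] that by (simp add: k_def kappa_def con_alg_def)
  assume \<gamma>: "\<gamma> \<subseteq> \<alpha>" "\<gamma> \<subseteq> pullback A h \<gamma>'"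
  have q: "is_hom ar (quot_alg (con_alg A \<alpha>) (Delta ar A \<alpha>)) (quot_alg (con_alg B \<beta>) (Delta ar B \<beta>)) k"
    unfolding k_def
    using is_algebra_con_alg[OF A \<alpha>] \<Delta> is_hom_con_alg[OF h sub] D by (rule is_hom_quot_map)
  \<comment> \<open>The operations of \<open>kappa_image\<close> are those of the full quotient, so
    this inclusion lets \<open>q\<close> supply the homomorphism equation.\<close>
  have sc: "carrier (kappa_image ar A \<alpha> \<gamma>) \<subseteq> carrier (quot_alg (con_alg A \<alpha>) (Delta ar A \<alpha>))"
    using \<gamma>(1) by (auto simp: kappa_image_def kappa_def quot_alg_def con_alg_def quotient_def)
  show "is_hom ar (kappa_image ar A \<alpha> \<gamma>) (kappa_image ar B \<beta> \<gamma>') k"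
    unfolding is_hom_def
  proof (intro conjI ballI allI impI)
    fix X assume "X \<in> carrier (kappa_image ar A \<alpha> \<gamma>)"
    then obtain x y where xy: "(x, y) \<in> \<gamma>" "X = kappa ar A \<alpha> (x, y)"
      by (auto simp: kappa_image_def con_alg_def)
    then have "k X = kappa ar B \<beta> (h x, h y)" using map \<gamma>(1) by blast
    moreover have "(h x, h y) \<in> \<gamma>'" using xy \<gamma>(2) by (auto simp: pullback_def)
    ultimately show "k X \<in> carrier (kappa_image ar B \<beta> \<gamma>')"
      by (simp add: kappa_image_def con_alg_def)
  next
    fix f Xs assume *: "length Xs = ar f \<and> set Xs \<subseteq> carrier (kappa_image ar A \<alpha> \<gamma>)"
    then have "set Xs \<subseteq> carrier (quot_alg (con_alg A \<alpha>) (Delta ar A \<alpha>))" using sc by blast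
    then show "k (oper (kappa_image ar A \<alpha> \<gamma>) f Xs) = oper (kappa_image ar B \<beta> \<gamma>') f (map k Xs)"
      using q * unfolding is_hom_def by (simp add: kappa_image_def)
  qed
qed

text \<open>Names elements of the multiplier by pairs from \<open>F\<close> itself, hiding both
  layers of classes; induced maps then act by applying \<open>f\<close> to both entries.\<close>

definition schur_class :: "('f \<Rightarrow> nat) \<Rightarrow> ('f, 'a) algebra \<Rightarrow> ('a \<times> 'a) set \<Rightarrow> 'a \<Rightarrow> 'a \<Rightarrow>
    ('a set \<times> 'a set) set" where
  "schur_class ar F \<alpha> x y = (let \<delta> = commutator ar F \<alpha> (top_con F)
    in kappa ar (quot_alg F \<delta>) (quot_con \<alpha> \<delta>) (\<delta> `` {x}, \<delta> `` {y}))"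

lemma carrier_schur_multiplier:
  "carrier (schur_multiplier ar F \<alpha>) = {schur_class ar F \<alpha> x y | x y.
    (x, y) \<in> \<alpha> \<inter> commutator ar F (top_con F) (top_con F)}"
  by (auto simp: schur_multiplier_def schur_class_def kappa_image_def con_alg_def quot_con_def Let_def)

locale presentation =
  fixes ar :: "'f \<Rightarrow> nat" and E :: "'f identities" and m :: 'f
    and F :: "('f, 'a) algebra" and \<alpha> :: "('a \<times> 'a) set"
  assumes E: "wf_identities ar E" and dt: "difference_term ar E m"
    and V: "in_variety ar E F" and con: "congruence ar F \<alpha>"
begin

definition "\<delta> = commutator ar F \<alpha> (top_con F)"
abbreviation "A \<equiv> quot_alg F \<delta>"
abbreviation "\<zeta> \<equiv> quot_con \<alpha> \<delta>"

lemma alg: "is_algebra ar F" using V by (simp add: in_variety_def)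

lemma con_top: "\<alpha> \<subseteq> top_con F" using congruence_subset[OF con] by (simp add: top_con_def)

lemma con_\<delta>: "congruence ar F \<delta>" and \<delta>_sub: "\<delta> \<subseteq> \<alpha>"
  unfolding \<delta>_def
  by (intro congruence_commutator commutator_subset_left alg con con_top order_refl)+

sublocale cc: central_congruence ar A m \<zeta>
  using E dt V con \<delta>_def by (rule central_congruence_quot)

end

lemma top_con_pullback: "is_hom ar A B h \<Longrightarrow> top_con A \<subseteq> pullback A h (top_con B)"
  by (auto simp: top_con_def pullback_def is_hom_def)

text \<open>\<open>fbar\<close> and \<open>schur_map\<close> are what \<open>f\<close> induces on
  the two successive quotients, by \<open>[\<alpha>,1]\<close> and then by
  \<open>Delta\<close>.\<close>

locale presentation_hom = F: presentation ar E m F \<alpha> + G: presentation ar E m G \<beta>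
  for ar :: "'f \<Rightarrow> nat" and E m and F :: "('f, 'a) algebra" and \<alpha>
    and G :: "('f, 'b) algebra" and \<beta> +
  fixes f :: "'a \<Rightarrow> 'b"
  assumes hom: "is_hom ar F G f" and sub: "\<alpha> \<subseteq> pullback F f \<beta>"
begin

definition "fbar = (\<lambda>X. G.\<delta> `` (f ` X))"

lemma \<delta>_pullback: "F.\<delta> \<subseteq> pullback F f G.\<delta>"
  unfolding F.\<delta>_def G.\<delta>_def by (rule commutator_hom[OF F.alg hom sub top_con_pullback[OF hom]])

lemma fbar_class: "x \<in> carrier F \<Longrightarrow> fbar (F.\<delta> `` {x}) = G.\<delta> `` {f x}"
  unfolding fbar_def by (rule class_image[OF F.con_\<delta> G.con_\<delta> \<delta>_pullback])

lemma is_hom_fbar: "is_hom ar F.A G.A fbar"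
  unfolding fbar_def by (rule is_hom_quot_map[OF F.alg F.con_\<delta> G.con_\<delta> hom \<delta>_pullback])

lemma quot_con_pullback:
  assumes "\<gamma> \<subseteq> pullback F f \<gamma>'"
  shows "quot_con \<gamma> F.\<delta> \<subseteq> pullback F.A fbar (quot_con \<gamma>' G.\<delta>)"
proof clarify
  fix X Y assume "(X, Y) \<in> quot_con \<gamma> F.\<delta>"
  then obtain x y where "(x, y) \<in> \<gamma>" and XY: "X = F.\<delta> `` {x}" "Y = F.\<delta> `` {y}"
    by (auto simp: quot_con_def)
  then have xy: "x \<in> carrier F" "y \<in> carrier F" "(f x, f y) \<in> \<gamma>'"
    using assms by (auto simp: pullback_def)
  have "(G.\<delta> `` {f x}, G.\<delta> `` {f y}) \<in> quot_con \<gamma>' G.\<delta>"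
    using xy(3) by (auto simp: quot_con_def)
  with xy show "(X, Y) \<in> pullback F.A fbar (quot_con \<gamma>' G.\<delta>)"
    by (simp add: pullback_def XY fbar_class quot_alg_def quotientI)
qed

definition "schur_map = (\<lambda>X. Delta ar G.A G.\<zeta> `` (map_prod fbar fbar ` X))"

lemma is_hom_schur_map:
  "is_hom ar (schur_multiplier ar F \<alpha>) (schur_multiplier ar G \<beta>) schur_map"
proof -
  let ?\<gamma> = "\<alpha> \<inter> commutator ar F (top_con F) (top_con F)"
  let ?\<gamma>' = "\<beta> \<inter> commutator ar G (top_con G) (top_con G)"
  have "?\<gamma> \<subseteq> pullback F f ?\<gamma>'"
    using sub commutator_hom[OF F.alg hom top_con_pullback[OF hom] top_con_pullback[OF hom]]
    by (auto simp: pullback_def)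
  then have *: "quot_con ?\<gamma> F.\<delta> \<subseteq> pullback F.A fbar (quot_con ?\<gamma>' G.\<delta>)"
    by (rule quot_con_pullback)
  have "is_hom ar (kappa_image ar F.A F.\<zeta> (quot_con ?\<gamma> F.\<delta>))
      (kappa_image ar G.A G.\<zeta> (quot_con ?\<gamma>' G.\<delta>)) schur_map"
  proof (rule is_hom_kappa_image[OF schur_map_def F.cc.alg F.cc.con is_hom_fbar quot_con_pullback[OF sub]
        F.cc.congruence_Delta G.cc.congruence_Delta _ *])
    show "quot_con ?\<gamma> F.\<delta> \<subseteq> F.\<zeta>" by (auto simp: quot_con_def)
  qed
  then show ?thesis by (simp add: schur_multiplier_def Let_def F.\<delta>_def G.\<delta>_def)
qed

lemma schur_map_class:
  assumes "(x, y) \<in> \<alpha>"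
  shows "schur_map (schur_class ar F \<alpha> x y) = schur_class ar G \<beta> (f x) (f y)"
proof -
  have xy: "x \<in> carrier F" "y \<in> carrier F" using congruence_subset[OF F.con] assms by auto
  have "(F.\<delta> `` {x}, F.\<delta> `` {y}) \<in> F.\<zeta>" using assms by (auto simp: quot_con_def)
  then have "schur_map (kappa ar F.A F.\<zeta> (F.\<delta> `` {x}, F.\<delta> `` {y}))
      = kappa ar G.A G.\<zeta> (G.\<delta> `` {f x}, G.\<delta> `` {f y})"
    unfolding fbar_class[OF xy(1), symmetric] fbar_class[OF xy(2), symmetric]
    by (rule kappa_map[OF schur_map_def F.cc.alg F.cc.con is_hom_fbar quot_con_pullback[OF sub]
        F.cc.congruence_Delta G.cc.congruence_Delta])
  then show ?thesis by (simp add: schur_class_def Let_def F.\<delta>_def G.\<delta>_def)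
qed

end

lemma (in presentation) schur_class_endomorphism:
  assumes h: "is_hom ar F F h" and h\<alpha>: "\<And>x. x \<in> carrier F \<Longrightarrow> (x, h x) \<in> \<alpha>"
    and xy: "(x, y) \<in> \<alpha> \<inter> commutator ar F (top_con F) (top_con F)"
  shows "schur_class ar F \<alpha> (h x) (h y) = schur_class ar F \<alpha> x y"
proof -
  have sub: "\<alpha> \<subseteq> pullback F h \<alpha>"
  proof clarify
    fix u v assume uv: "(u, v) \<in> \<alpha>"
    then have c: "u \<in> carrier F" "v \<in> carrier F" using congruence_subset[OF con] by auto
    have "(h u, h v) \<in> \<alpha>"
      by (rule congruence_trans[OF con congruence_sym[OF con h\<alpha>[OF c(1)]]
            congruence_trans[OF con uv h\<alpha>[OF c(2)]]])
    with c show "(u, v) \<in> pullback F h \<alpha>" by (simp add: pullback_def)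
  qed
  \<comment> \<open>With \<open>F\<close> at both ends, \<open>h.fbar\<close> is an endomorphism of
    \<open>A\<close> that moves elements only within \<open>\<zeta>\<close>-classes.\<close>
  interpret h: presentation_hom ar E m F \<alpha> F \<alpha> h
    by unfold_locales (fact h sub)+
  have c: "x \<in> carrier F" "y \<in> carrier F" using xy congruence_subset[OF con] by auto
  have "((\<delta> `` {x}, \<delta> `` {y}), (h.fbar (\<delta> `` {x}), h.fbar (\<delta> `` {y}))) \<in> Delta ar A \<zeta>"
  proof (rule cc.Delta_endomorphism[OF h.is_hom_fbar])
    fix X assume "X \<in> carrier A"
    then obtain u where u: "u \<in> carrier F" "X = \<delta> `` {u}"
      by (auto simp: quot_alg_def elim: quotientE)
    then show "(X, h.fbar X) \<in> \<zeta>" using h\<alpha>[OF u(1)] by (auto simp: h.fbar_class quot_con_def)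
  next
    show "(\<delta> `` {x}, \<delta> `` {y}) \<in> \<zeta>" using xy by (auto simp: quot_con_def)
    \<comment> \<open>The projection carries \<open>[1,1]\<close> of \<open>F\<close> into
      \<open>[1,1]\<close> of the quotient.\<close>
    show "(\<delta> `` {x}, \<delta> `` {y}) \<in> commutator ar A (top_con A) (top_con A)"
      using commutator_hom[OF alg is_hom_quot_proj[OF con_\<delta>]
          top_con_pullback[OF is_hom_quot_proj[OF con_\<delta>]]
          top_con_pullback[OF is_hom_quot_proj[OF con_\<delta>]]] xy
      by (auto simp: pullback_def)
  qed
  then have "((\<delta> `` {x}, \<delta> `` {y}), (\<delta> `` {h x}, \<delta> `` {h y})) \<in> Delta ar A \<zeta>"
    using c by (simp add: h.fbar_class)
  moreover have "equiv (carrier (con_alg A \<zeta>)) (Delta ar A \<zeta>)"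
    using cc.congruence_Delta by (simp add: congruence_def)
  ultimately have "kappa ar A \<zeta> (\<delta> `` {x}, \<delta> `` {y}) = kappa ar A \<zeta> (\<delta> `` {h x}, \<delta> `` {h y})"
    unfolding kappa_def by (rule equiv_class_eq[rotated])
  then show ?thesis by (simp add: schur_class_def Let_def \<delta>_def)
qed

theorem theorem7p1:
  fixes ar :: "'f \<Rightarrow> nat" and E :: "'f identities" and m :: 'f
    and Q :: "('f, 'q) algebra"
    and F :: "('f, 'a) algebra" and \<alpha> :: "('a \<times> 'a) set"
    and G :: "('f, 'b) algebra" and \<beta> :: "('b \<times> 'b) set"
  assumes "wf_identities ar E"
    and "difference_term ar E m"
    and "in_variety ar E Q"
    and "free_presentation ar E F \<alpha> Q"
    and "free_presentation ar E G \<beta> Q"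
  shows "isomorphic ar (schur_multiplier ar F \<alpha>) (schur_multiplier ar G \<beta>)"
proof -
  note E = assms(1) and dt = assms(2)
  have free: "free_algebra ar E F" "free_algebra ar E G"
    and con: "congruence ar F \<alpha>" "congruence ar G \<beta>"
    using assms(4,5) by (simp_all add: free_presentation_def)
  then have V: "in_variety ar E F" "in_variety ar E G"
    by (auto simp: free_algebra_def freely_generated_def)
  obtain p where p: "is_hom ar F Q p" "carrier Q \<subseteq> p ` carrier F" "\<alpha> = pullback F p Id"
    using free_presentation_map[OF assms(4)] .
  obtain q where q: "is_hom ar G Q q" "carrier Q \<subseteq> q ` carrier G" "\<beta> = pullback G q Id"
    using free_presentation_map[OF assms(5)] .
  obtain f where f: "is_hom ar F G f" "\<And>x. x \<in> carrier F \<Longrightarrow> q (f x) = p x"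
    by (rule free_algebra_lift[OF E free(1) V(2) p(1) q(1,2)]) blast
  obtain g where g: "is_hom ar G F g" "\<And>x. x \<in> carrier G \<Longrightarrow> p (g x) = q x"
    by (rule free_algebra_lift[OF E free(2) V(1) q(1) p(1,2)]) blast
  have fc: "f x \<in> carrier G" if "x \<in> carrier F" for x using f(1) that by (simp add: is_hom_def)
  have gc: "g x \<in> carrier F" if "x \<in> carrier G" for x using g(1) that by (simp add: is_hom_def)
  interpret F: presentation ar E m F \<alpha> by unfold_locales (fact E dt V con)+
  interpret G: presentation ar E m G \<beta> by unfold_locales (fact E dt V con)+
  \<comment> \<open>\<open>f\<close> carries \<open>\<alpha>\<close> into \<open>\<beta>\<close>:
    these are the kernels of \<open>p\<close> and \<open>q\<close>, and
    \<open>q (f x) = p x\<close>.\<close>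
  interpret f: presentation_hom ar E m F \<alpha> G \<beta> f
    by unfold_locales (use f fc p(3) q(3) in \<open>auto simp: pullback_def\<close>)
  interpret g: presentation_hom ar E m G \<beta> F \<alpha> g
    by unfold_locales (use g gc p(3) q(3) in \<open>auto simp: pullback_def\<close>)
  \<comment> \<open>\<open>p (g (f x)) = q (f x) = p x\<close>, and \<open>\<alpha>\<close> is the
    kernel of \<open>p\<close>.\<close>
  have gf: "(x, g (f x)) \<in> \<alpha>" if "x \<in> carrier F" for x
    using that f(2) g(2) fc gc unfolding p(3) pullback_def by simp
  have fg: "(x, f (g x)) \<in> \<beta>" if "x \<in> carrier G" for x
    using that f(2) g(2) fc gc unfolding q(3) pullback_def by simp
  have "bij_betw f.schur_map (carrier (schur_multiplier ar F \<alpha>)) (carrier (schur_multiplier ar G \<beta>))"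
  proof (rule bij_betw_byWitness[where f' = g.schur_map])
    show "\<forall>X\<in>carrier (schur_multiplier ar F \<alpha>). g.schur_map (f.schur_map X) = X"
    proof
      fix X assume "X \<in> carrier (schur_multiplier ar F \<alpha>)"
      then obtain x y where xy: "(x, y) \<in> \<alpha> \<inter> commutator ar F (top_con F) (top_con F)"
        and X: "X = schur_class ar F \<alpha> x y"
        unfolding carrier_schur_multiplier by blast
      then have "(f x, f y) \<in> \<beta>" using f.sub by (auto simp: pullback_def)
      then have "g.schur_map (f.schur_map X) = schur_class ar F \<alpha> (g (f x)) (g (f y))"
        using xy by (simp add: X f.schur_map_class g.schur_map_class)
      also have "\<dots> = X"
        unfolding X using is_hom_comp[OF f(1) g(1)] gf xy by (rule F.schur_class_endomorphism)
      finally show "g.schur_map (f.schur_map X) = X" .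
    qed
    show "\<forall>X\<in>carrier (schur_multiplier ar G \<beta>). f.schur_map (g.schur_map X) = X"
    proof
      fix X assume "X \<in> carrier (schur_multiplier ar G \<beta>)"
      then obtain x y where xy: "(x, y) \<in> \<beta> \<inter> commutator ar G (top_con G) (top_con G)"
        and X: "X = schur_class ar G \<beta> x y"
        unfolding carrier_schur_multiplier by blast
      then have "(g x, g y) \<in> \<alpha>" using g.sub by (auto simp: pullback_def)
      then have "f.schur_map (g.schur_map X) = schur_class ar G \<beta> (f (g x)) (f (g y))"
        using xy by (simp add: X f.schur_map_class g.schur_map_class)
      also have "\<dots> = X"
        unfolding X using is_hom_comp[OF g(1) f(1)] fg xy by (rule G.schur_class_endomorphism)
      finally show "f.schur_map (g.schur_map X) = X" .
    qed
    show "f.schur_map ` carrier (schur_multiplier ar F \<alpha>) \<subseteq> carrier (schur_multiplier ar G \<beta>)"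
      using f.is_hom_schur_map by (auto simp: is_hom_def)
    show "g.schur_map ` carrier (schur_multiplier ar G \<beta>) \<subseteq> carrier (schur_multiplier ar F \<alpha>)"
      using g.is_hom_schur_map by (auto simp: is_hom_def)
  qed
  with f.is_hom_schur_map show ?thesis unfolding isomorphic_def by blast
qed

end
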